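(* Consider the map $\mathcal D_p\colon(X,A)\mapsto(\mathcal D_p(X,A),\sigma_\varnothing)$, acting on a relative Lipschitz map $f\colon(X,A)\to(Y,B)$ by $f\mapsto f_*$, where for a persistence diagram $\sigma\in\mathcal D_p(X,A)$ the diagram $f_*(\sigma)$ is given by the multiset $\{f(x):x\in\sigma\}$. (1) If $p=\infty$, then $\mathcal D_p$ is a functor from the category of metric pairs equipped with relative Lipschitz maps to the category of pointed pseudometric spaces with pointed Lipschitz maps. (2) If $1\le p<\infty$, then $\mathcal D_p$ is a functor from the category of metric pairs equipped with relative Lipschitz maps to the category of pointed metric spaces with pointed Lipschitz maps.
   Context: A metric pair $(X,A)$ is a metric space $(X,d)$ together with a non-empty closed subset $A\subseteq X$. A relative Lipschitz map $f\colon(X,A)\to(Y,B)$ is a Lipschitz map $f\colon X\to Y$ with $f(A)\subseteq B$. A pointed Lipschitz map is a Lipschitz map sending base point to base point. Persistence diagrams ($1\le p\le\infty$): for a set $Y$, let $\widetilde{\mathcal D}(Y)$ be the set of countable (finite or countably infinite) multisets of elements of $Y$; the sum of two multisets is their disjoint union. For $\widetilde\sigma,\widetilde\tau\in\widetilde{\mathcal D}(X)$ put $\widetilde d_p(\widetilde\sigma,\widetilde\tau)=\inf_\phi\big(\sum_{x\in\widetilde\sigma}d(x,\phi(x))^p\big)^{1/p}$ if $p<\infty$ and $\widetilde d_\infty(\widetilde\sigma,\widetilde\tau)=\inf_\phi\sup_{x\in\widetilde\sigma}d(x,\phi(x))$, over all bijections $\phi\colon\widetilde\sigma\to\widetilde\tau$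 of multisets ($\inf\varnothing=\infty$). Write $\widetilde\sigma\sim_A\widetilde\tau$ if $\widetilde\sigma+\widetilde\alpha=\widetilde\tau+\widetilde\beta$ for some $\widetilde\alpha,\widetilde\beta\in\widetilde{\mathcal D}(A)$; let $\mathcal D(X,A)=\widetilde{\mathcal D}(X)/\!\sim_A$, with $\sigma$ the class of $\widetilde\sigma$ and $\sigma_\varnothing$ the class of the empty multiset. Put $d_p(\sigma,\tau)=\inf_{\widetilde\alpha,\widetilde\beta\in\widetilde{\mathcal D}(A)}\widetilde d_p(\widetilde\sigma+\widetilde\alpha,\widetilde\tau+\widetilde\beta)$ and $\mathcal D_p(X,A)=\{\sigma: d_p(\sigma,\sigma_\varnothing)<\infty\}$ with $d_p$. Diagrams are treated as multisets via representatives. *)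

theory Defs
  imports "HOL-Analysis.Analysis"
begin

section \<open>Categories and functors\<close>

record ('o, 'm) cat =
  Obj :: "'o set"
  Hom :: "'o \<Rightarrow> 'o \<Rightarrow> 'm set"
  Idt :: "'o \<Rightarrow> 'm"
  Cmp :: "'o \<Rightarrow> 'o \<Rightarrow> 'o \<Rightarrow> 'm \<Rightarrow> 'm \<Rightarrow> 'm"

text \<open>
  \<^term>\<open>Cmp C a b c g f\<close> is the composite of \<open>f : a \<rightarrow> b\<close> followed by \<open>g : b \<rightarrow> c\<close>.
\<close>

locale category =
  fixes C :: "('o, 'm) cat"
  assumes Idt_in_Hom: "a \<in> Obj C \<Longrightarrow> Idt C a \<in> Hom C a a"
    and Cmp_in_Hom: "\<lbrakk>a \<in> Obj C; b \<in> Obj C; c \<in> Obj C; f \<in> Hom C a b; g \<in> Hom C b c\<rbrakk>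
      \<Longrightarrow> Cmp C a b c g f \<in> Hom C a c"
    and Cmp_Idt_left: "\<lbrakk>a \<in> Obj C; b \<in> Obj C; f \<in> Hom C a b\<rbrakk>
      \<Longrightarrow> Cmp C a b b (Idt C b) f = f"
    and Cmp_Idt_right: "\<lbrakk>a \<in> Obj C; b \<in> Obj C; f \<in> Hom C a b\<rbrakk>
      \<Longrightarrow> Cmp C a a b f (Idt C a) = f"
    and Cmp_assoc: "\<lbrakk>a \<in> Obj C; b \<in> Obj C; c \<in> Obj C; d \<in> Obj C;
        f \<in> Hom C a b; g \<in> Hom C b c; h \<in> Hom C c d\<rbrakk>
      \<Longrightarrow> Cmp C a c d h (Cmp C a b c g f) = Cmp C a b d (Cmp C b c d h g) f"

locale cat_functor = C: category C + D: category D
  for C :: "('o, 'm) cat" and D :: "('q, 'n) cat" +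
  fixes Fo :: "'o \<Rightarrow> 'q" and Fm :: "'o \<Rightarrow> 'o \<Rightarrow> 'm \<Rightarrow> 'n"
  assumes Fo_in_Obj: "a \<in> Obj C \<Longrightarrow> Fo a \<in> Obj D"
    and Fm_in_Hom: "\<lbrakk>a \<in> Obj C; b \<in> Obj C; f \<in> Hom C a b\<rbrakk>
      \<Longrightarrow> Fm a b f \<in> Hom D (Fo a) (Fo b)"
    and Fm_Idt: "a \<in> Obj C \<Longrightarrow> Fm a a (Idt C a) = Idt D (Fo a)"
    and Fm_Cmp: "\<lbrakk>a \<in> Obj C; b \<in> Obj C; c \<in> Obj C; f \<in> Hom C a b; g \<in> Hom C b c\<rbrakk>
      \<Longrightarrow> Fm a c (Cmp C a b c g f) = Cmp D (Fo a) (Fo b) (Fo c) (Fm b c g) (Fm a b f)"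


section \<open>Metric pairs and relative Lipschitz maps\<close>

text \<open>
  The underlying set of a metric pair is a subset of the type \<^typ>\<open>'a\<close>, which is arbitrary and
  plays the role of the universe; the sets underlying different pairs are unrelated subsets of it.
  (Pairs over different types can be compared inside a sum type.)
  Here and below a morphism is a function that is extensional on the underlying set
  of its domain, so that equality of morphisms is equality of maps.
\<close>

definition metric_pair :: "'a metric \<times> 'a set \<Rightarrow> bool" where
  "metric_pair P \<longleftrightarrow> (case P of (X, A) \<Rightarrow> closedin (mtopology_of X) A \<and> A \<noteq> {})"

definition rel_Lipschitz_maps ::
    "'a metric \<times> 'a set \<Rightarrow> 'a metric \<times> 'a set \<Rightarrow> ('a \<Rightarrow> 'a) set" where
  "rel_Lipschitz_maps P Q = (case P of (X, A) \<Rightarrow> case Q of (Y, B) \<Rightarrow>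
     {f \<in> extensional (mspace X). Lipschitz_continuous_map X Y f \<and> f ` A \<subseteq> B})"

definition MetPairs :: "('a metric \<times> 'a set, 'a \<Rightarrow> 'a) cat" where
  "MetPairs =
    \<lparr>Obj = {P. metric_pair P},
     Hom = rel_Lipschitz_maps,
     Idt = (\<lambda>(X, A). restrict id (mspace X)),
     Cmp = (\<lambda>(X, A) _ _ g f. compose (mspace X) g f)\<rparr>"


section \<open>Pointed (pseudo)metric spaces and pointed Lipschitz maps\<close>

text \<open>
  A pointed space is a triple of carrier, distance and base point.  The distance is typed
  with values in \<^typ>\<open>ennreal\<close>, but is required to be finite on the carrier.
\<close>

type_synonym 'b pointed_space = "'b set \<times> ('b \<Rightarrow> 'b \<Rightarrow> ennreal) \<times> 'b"

definition pointed_pseudometric_space :: "'b pointed_space \<Rightarrow> bool" where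
  "pointed_pseudometric_space S \<longleftrightarrow> (case S of (M, d, b) \<Rightarrow>
     b \<in> M \<and>
     (\<forall>x\<in>M. \<forall>y\<in>M. d x y < \<infinity>) \<and>
     (\<forall>x\<in>M. d x x = 0) \<and>
     (\<forall>x\<in>M. \<forall>y\<in>M. d x y = d y x) \<and>
     (\<forall>x\<in>M. \<forall>y\<in>M. \<forall>z\<in>M. d x z \<le> d x y + d y z))"

definition pointed_metric_space :: "'b pointed_space \<Rightarrow> bool" where
  "pointed_metric_space S \<longleftrightarrow> (case S of (M, d, b) \<Rightarrow>
     pointed_pseudometric_space (M, d, b) \<and> (\<forall>x\<in>M. \<forall>y\<in>M. d x y = 0 \<longrightarrow> x = y))"

definition pointed_Lipschitz_maps :: "'b pointed_space \<Rightarrow> 'b pointed_space \<Rightarrow> ('b \<Rightarrow> 'b) set" where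
  "pointed_Lipschitz_maps S T = (case S of (M, d, b) \<Rightarrow> case T of (M', d', b') \<Rightarrow>
     {f \<in> M \<rightarrow>\<^sub>E M'. f b = b' \<and>
        (\<exists>L::real. \<forall>x\<in>M. \<forall>y\<in>M. d' (f x) (f y) \<le> ennreal L * d x y)})"

definition PtPseudoMet :: "('b pointed_space, 'b \<Rightarrow> 'b) cat" where
  "PtPseudoMet =
    \<lparr>Obj = {S. pointed_pseudometric_space S},
     Hom = pointed_Lipschitz_maps,
     Idt = (\<lambda>(M, d, b). restrict id M),
     Cmp = (\<lambda>(M, d, b) _ _ g f. compose M g f)\<rparr>"

definition PtMet :: "('b pointed_space, 'b \<Rightarrow> 'b) cat" where
  "PtMet = PtPseudoMet\<lparr>Obj := {S. pointed_metric_space S}\<rparr>"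

text \<open>
  On the carrier, such a distance is a metric in the sense of \<^const>\<open>Metric_space\<close>; the modification off
  the carrier is needed because \<^const>\<open>Metric_space\<close> also asks for symmetry there.
\<close>

lemma pointed_metric_space_iff_Metric_space:
  "pointed_metric_space (M, d, b) \<longleftrightarrow>
     b \<in> M \<and> (\<forall>x\<in>M. \<forall>y\<in>M. d x y < \<infinity>) \<and>
     Metric_space M (\<lambda>x y. if x \<in> M \<and> y \<in> M then enn2real (d x y) else 0)"
proof (cases "\<forall>x\<in>M. \<forall>y\<in>M. d x y < \<infinity>")
  case True
  define e where "e x y = enn2real (d x y)" for x y
  have d: "d x y = ennreal (e x y)" if "x \<in> M" "y \<in> M" for x y
    using True that by (simp add: e_def)
  have e: "0 \<le> e x y" for x y by (simp add: e_def)
  have zero: "d x y = 0 \<longleftrightarrow> e x y = 0" if "x \<in> M" "y \<in> M" for x y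
    using d[OF that] e[of x y] by (simp add: ennreal_eq_0_iff)
  have comm: "d x y = d y x \<longleftrightarrow> e x y = e y x" if "x \<in> M" "y \<in> M" for x y
    using d[of x y] d[of y x] e that by simp
  have tri: "d x z \<le> d x y + d y z \<longleftrightarrow> e x z \<le> e x y + e y z" if "x \<in> M" "y \<in> M" "z \<in> M" for x y z
    using d e that by (simp flip: ennreal_plus)
  have "pointed_metric_space (M, d, b) \<longleftrightarrow>
      b \<in> M \<and> (\<forall>x\<in>M. e x x = 0) \<and> (\<forall>x\<in>M. \<forall>y\<in>M. e x y = e y x) \<and>
      (\<forall>x\<in>M. \<forall>y\<in>M. \<forall>z\<in>M. e x z \<le> e x y + e y z) \<and> (\<forall>x\<in>M. \<forall>y\<in>M. e x y = 0 \<longrightarrow> x = y)"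
    using True
    by (simp add: pointed_metric_space_def pointed_pseudometric_space_def zero comm tri cong: ball_cong)
  also have "\<dots> \<longleftrightarrow> b \<in> M \<and> Metric_space M (\<lambda>x y. if x \<in> M \<and> y \<in> M then e x y else 0)"
    unfolding Metric_space_def using e by auto
  finally show ?thesis using True unfolding e_def by simp
qed (auto simp: pointed_metric_space_def pointed_pseudometric_space_def)


section \<open>Countable multisets\<close>

text \<open>
  A countable multiset is given by its multiplicity function with values in \<^typ>\<open>enat\<close>; an element
  may occur infinitely often.  \<open>occ s\<close> lists the occurrences: \<open>x\<close> appears in it
  as \<open>(x, 0), (x, 1), \<dots>\<close>, as often as its multiplicity says.
\<close>

type_synonym 'a cmset = "'a \<Rightarrow> enat"

definition cmsets :: "'a set \<Rightarrow> 'a cmset set" where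
  "cmsets Y = {s. countable {x. s x \<noteq> 0} \<and> {x. s x \<noteq> 0} \<subseteq> Y}"

definition cm_empty :: "'a cmset" where
  "cm_empty = (\<lambda>_. 0)"

definition cm_add :: "'a cmset \<Rightarrow> 'a cmset \<Rightarrow> 'a cmset"  (infixl "\<oplus>\<^sub>m" 65) where
  "s \<oplus>\<^sub>m t = (\<lambda>x. s x + t x)"

definition occ :: "'a cmset \<Rightarrow> ('a \<times> nat) set" where
  "occ s = {(x, n). enat n < s x}"

definition ecard :: "'b set \<Rightarrow> enat" where
  "ecard S = (if finite S then enat (card S) else \<infinity>)"

definition cm_image :: "('a \<Rightarrow> 'b) \<Rightarrow> 'a cmset \<Rightarrow> 'b cmset" where
  "cm_image f s = (\<lambda>y. ecard {u \<in> occ s. f (fst u) = y})"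


section \<open>Persistence diagrams\<close>

text \<open>
  For \<open>p < \<infinity>\<close>, \<open>lp_size p I w\<close> is the \<open>p\<close>-th root of the sum of the \<open>p\<close>-th powers
  of the non-negative weights \<open>w i\<close>, and it is infinite if that sum is.
\<close>

definition lp_size :: "ennreal \<Rightarrow> 'i set \<Rightarrow> ('i \<Rightarrow> real) \<Rightarrow> ennreal" where
  "lp_size p I w =
     (if p = \<infinity> then (SUP i\<in>I. ennreal (w i))
      else let r = enn2real p; S = (\<Sum>\<^sub>\<infinity>i\<in>I. ennreal (w i powr r))
           in if S = \<infinity> then \<infinity> else ennreal (enn2real S powr (1 / r)))"

definition cm_dist :: "'a metric \<Rightarrow> ennreal \<Rightarrow> 'a cmset \<Rightarrow> 'a cmset \<Rightarrow> ennreal" where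
  "cm_dist X p s t =
     (INF \<phi>\<in>{\<phi>. bij_betw \<phi> (occ s) (occ t)}.
        lp_size p (occ s) (\<lambda>u. mdist X (fst u) (fst (\<phi> u))))"

definition diag_rel :: "'a metric \<times> 'a set \<Rightarrow> ('a cmset \<times> 'a cmset) set" where
  "diag_rel P = (case P of (X, A) \<Rightarrow>
     {(s, t). s \<in> cmsets (mspace X) \<and> t \<in> cmsets (mspace X) \<and>
        (\<exists>\<alpha>\<in>cmsets A. \<exists>\<beta>\<in>cmsets A. s \<oplus>\<^sub>m \<alpha> = t \<oplus>\<^sub>m \<beta>)})"

type_synonym 'a diagram = "'a cmset set"

definition diag_class :: "'a metric \<times> 'a set \<Rightarrow> 'a cmset \<Rightarrow> 'a diagram" where
  "diag_class P s = diag_rel P `` {s}"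

definition diagrams :: "'a metric \<times> 'a set \<Rightarrow> 'a diagram set" where
  "diagrams P = cmsets (mspace (fst P)) // diag_rel P"

definition empty_diagram :: "'a metric \<times> 'a set \<Rightarrow> 'a diagram" where
  "empty_diagram P = diag_class P cm_empty"

definition rep_dist :: "'a metric \<times> 'a set \<Rightarrow> ennreal \<Rightarrow> 'a cmset \<Rightarrow> 'a cmset \<Rightarrow> ennreal" where
  "rep_dist P p s t = (case P of (X, A) \<Rightarrow>
     (INF \<alpha>\<in>cmsets A. INF \<beta>\<in>cmsets A. cm_dist X p (s \<oplus>\<^sub>m \<alpha>) (t \<oplus>\<^sub>m \<beta>)))"

text \<open>
  The value of \<^const>\<open>rep_dist\<close> does not depend on the representatives (lemma
  \<open>diag_dist_class\<close> below); the infimum over all of them only avoids a choice.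
\<close>

definition diag_dist :: "'a metric \<times> 'a set \<Rightarrow> ennreal \<Rightarrow> 'a diagram \<Rightarrow> 'a diagram \<Rightarrow> ennreal" where
  "diag_dist P p \<sigma> \<tau> = (INF s\<in>\<sigma>. INF t\<in>\<tau>. rep_dist P p s t)"

definition fin_diagrams :: "'a metric \<times> 'a set \<Rightarrow> ennreal \<Rightarrow> 'a diagram set" where
  "fin_diagrams P p = {\<sigma> \<in> diagrams P. diag_dist P p \<sigma> (empty_diagram P) < \<infinity>}"


subsection \<open>Independence of representatives\<close>

lemma cm_add_assoc: "(s \<oplus>\<^sub>m t) \<oplus>\<^sub>m u = s \<oplus>\<^sub>m (t \<oplus>\<^sub>m u)"
  by (simp add: cm_add_def add.assoc)

lemma cm_add_commute: "s \<oplus>\<^sub>m t = t \<oplus>\<^sub>m s"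
  by (simp add: cm_add_def add.commute)

lemma cm_add_in_cmsets:
  assumes "s \<in> cmsets Y" "t \<in> cmsets Y"
  shows "s \<oplus>\<^sub>m t \<in> cmsets Y"
proof -
  have "{x. (s \<oplus>\<^sub>m t) x \<noteq> 0} = {x. s x \<noteq> 0} \<union> {x. t x \<noteq> 0}"
    by (auto simp: cm_add_def)
  then show ?thesis using assms by (auto simp: cmsets_def)
qed

lemma cm_empty_in_cmsets: "cm_empty \<in> cmsets Y"
  by (simp add: cmsets_def cm_empty_def)

lemma cmsets_mono: "A \<subseteq> B \<Longrightarrow> cmsets A \<subseteq> cmsets B"
  by (auto simp: cmsets_def)

lemma finite_below_enat: "finite {n. enat n < m} \<longleftrightarrow> m \<noteq> \<infinity>"
  by (cases m) auto

lemma below_add_bij: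
  "\<exists>h. bij_betw h ({n. enat n < a} <+> {n. enat n < b}) {n. enat n < a + b}"
proof (cases "a = \<infinity> \<or> b = \<infinity>")
  case True
  then have *: "infinite ({n. enat n < a} <+> {n. enat n < b})" "infinite {n. enat n < a + b}"
    by (auto simp: finite_below_enat)
  have "bij_betw (from_nat_into ({n. enat n < a} <+> {n. enat n < b})) UNIV
      ({n. enat n < a} <+> {n. enat n < b})"
    using *(1) by (intro bij_betw_from_nat_into countable_Plus) auto
  moreover have "bij_betw (from_nat_into {n. enat n < a + b}) UNIV {n. enat n < a + b}"
    using *(2) by (intro bij_betw_from_nat_into) auto
  ultimately show ?thesis
    using bij_betw_inv_into bij_betw_trans by blast
next
  case False
  then obtain k l where "a = enat k" "b = enat l" by auto
  then have "{n. enat n < a} = {..<k}" "{n. enat n < b} = {..<l}" "{n. enat n < a + b} = {..<k + l}"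
    by auto
  then show ?thesis by (simp add: finite_same_card_bij card_Plus)
qed

lemma occ_add_bij:
  obtains h where "bij_betw h (occ s <+> occ t) (occ (s \<oplus>\<^sub>m t))"
    "\<And>u. u \<in> occ s \<Longrightarrow> fst (h (Inl u)) = fst u" "\<And>u. u \<in> occ t \<Longrightarrow> fst (h (Inr u)) = fst u"
proof -
  have "\<forall>x. \<exists>h. bij_betw h ({n. enat n < s x} <+> {n. enat n < t x}) {n. enat n < s x + t x}"
    by (intro allI below_add_bij)
  from choice[OF this] obtain h where h: "\<And>x. bij_betw (h x)
      ({n. enat n < s x} <+> {n. enat n < t x}) {n. enat n < s x + t x}"
    by blast
  define H where "H = (\<lambda>z. case z of Inl (x, n) \<Rightarrow> (x, h x (Inl n)) | Inr (x, n) \<Rightarrow> (x, h x (Inr n)))"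
  have "inj_on H (occ s <+> occ t)"
  proof (rule inj_onI)
    fix z z' assume z: "z \<in> occ s <+> occ t" "z' \<in> occ s <+> occ t" "H z = H z'"
    define split :: "('a \<times> nat) + ('a \<times> nat) \<Rightarrow> 'a \<times> (nat + nat)"
      where "split = (\<lambda>z. case z of Inl (x, n) \<Rightarrow> (x, Inl n) | Inr (x, n) \<Rightarrow> (x, Inr n))"
    have *: "H w = (fst (split w), h (fst (split w)) (snd (split w)))" for w
      by (auto simp: H_def split_def split: sum.split)
    have **: "snd (split w) \<in> {n. enat n < s (fst (split w))} <+> {n. enat n < t (fst (split w))}"
      if "w \<in> occ s <+> occ t" for w
      using that by (auto simp: split_def occ_def)
    have "fst (split z) = fst (split z')" using z(3) by (simp add: *)
    moreover from this have "snd (split z) = snd (split z')"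
      using z(3) **[OF z(1)] **[OF z(2)] bij_betw_imp_inj_on[OF h[of "fst (split z)"]]
      by (simp add: * inj_on_def)
    ultimately have "split z = split z'" by (simp add: prod_eq_iff)
    then show "z = z'" by (auto simp: split_def split: sum.splits)
  qed
  moreover have "H ` (occ s <+> occ t) = occ (s \<oplus>\<^sub>m t)"
  proof (intro set_eqI iffI)
    fix v assume "v \<in> H ` (occ s <+> occ t)"
    then show "v \<in> occ (s \<oplus>\<^sub>m t)"
      using bij_betwE[OF h] by (fastforce simp: H_def occ_def cm_add_def)
  next
    fix v assume "v \<in> occ (s \<oplus>\<^sub>m t)"
    then obtain x n where v: "v = (x, n)" "n \<in> {n. enat n < s x + t x}"
      by (auto simp: occ_def cm_add_def)
    from v(2) have "n \<in> h x ` ({n. enat n < s x} <+> {n. enat n < t x})"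
      using bij_betw_imp_surj_on[OF h[of x]] by blast
    then obtain z where z: "z \<in> {n. enat n < s x} <+> {n. enat n < t x}" "n = h x z" by blast
    from z(1) consider (1) m where "z = Inl m" "enat m < s x" | (2) m where "z = Inr m" "enat m < t x"
      by auto
    then show "v \<in> H ` (occ s <+> occ t)"
    proof cases
      case (1 m)
      then have "v = H (Inl (x, m))" "Inl (x, m) \<in> occ s <+> occ t"
        using v z by (auto simp: H_def occ_def)
      then show ?thesis by blast
    next
      case (2 m)
      then have "v = H (Inr (x, m))" "Inr (x, m) \<in> occ s <+> occ t"
        using v z by (auto simp: H_def occ_def)
      then show ?thesis by blast
    qed
  qed
  ultimately have "bij_betw H (occ s <+> occ t) (occ (s \<oplus>\<^sub>m t))"
    by (simp add: bij_betw_def)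
  then show thesis
    by (rule that) (auto simp: H_def)
qed

lemma lp_size_reindex:
  assumes "bij_betw h I J"
  shows "lp_size p J w = lp_size p I (\<lambda>i. w (h i))"
proof -
  have "(SUP j\<in>J. ennreal (w j)) = (SUP i\<in>I. ennreal (w (h i)))"
    using bij_betw_imp_surj_on[OF assms] by (metis image_image)
  moreover have "(\<Sum>\<^sub>\<infinity>j\<in>J. ennreal (w j powr r)) = (\<Sum>\<^sub>\<infinity>i\<in>I. ennreal (w (h i) powr r))" for r
    using infsum_reindex_bij_betw[OF assms, of "\<lambda>j. ennreal (w j powr r)"] by simp
  ultimately show ?thesis by (simp add: lp_size_def)
qed

lemma lp_size_neutral:
  assumes "I \<subseteq> J" "\<And>j. j \<in> J - I \<Longrightarrow> w j = 0"
  shows "lp_size p J w = lp_size p I w"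
proof -
  have "(SUP j\<in>J. ennreal (w j)) = (SUP i\<in>I. ennreal (w i))"
  proof (rule antisym)
    show "(SUP j\<in>J. ennreal (w j)) \<le> (SUP i\<in>I. ennreal (w i))"
    proof (rule SUP_least)
      fix j assume "j \<in> J"
      then show "ennreal (w j) \<le> (SUP i\<in>I. ennreal (w i))"
        using assms(2)[of j] by (cases "j \<in> I") (auto intro: SUP_upper)
    qed
  qed (use assms(1) in \<open>auto intro: SUP_subset_mono\<close>)
  moreover have "(\<Sum>\<^sub>\<infinity>j\<in>J. ennreal (w j powr r)) = (\<Sum>\<^sub>\<infinity>i\<in>I. ennreal (w i powr r))" for r
    by (rule infsum_cong_neutral) (use assms in auto)
  ultimately show ?thesis by (simp add: lp_size_def)
qed

lemma cm_dist_add_le: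
  assumes g: "g \<in> cmsets (mspace X)"
  shows "cm_dist X p (s \<oplus>\<^sub>m g) (t \<oplus>\<^sub>m g) \<le> cm_dist X p s t"
  unfolding cm_dist_def[of X p s t]
proof (rule INF_greatest)
  fix \<phi> assume "\<phi> \<in> {\<phi>. bij_betw \<phi> (occ s) (occ t)}"
  then have \<phi>: "bij_betw \<phi> (occ s) (occ t)" by simp
  obtain h where h: "bij_betw h (occ s <+> occ g) (occ (s \<oplus>\<^sub>m g))"
    "\<And>u. u \<in> occ s \<Longrightarrow> fst (h (Inl u)) = fst u" "\<And>u. u \<in> occ g \<Longrightarrow> fst (h (Inr u)) = fst u"
    by (rule occ_add_bij[of s g], rule that, simp_all)
  obtain k where k: "bij_betw k (occ t <+> occ g) (occ (t \<oplus>\<^sub>m g))"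
    "\<And>u. u \<in> occ t \<Longrightarrow> fst (k (Inl u)) = fst u" "\<And>u. u \<in> occ g \<Longrightarrow> fst (k (Inr u)) = fst u"
    by (rule occ_add_bij[of t g], rule that, simp_all)
  define m where "m = map_sum \<phi> (id :: 'a \<times> nat \<Rightarrow> _)"
  define \<psi> where "\<psi> = k \<circ> m \<circ> inv_into (occ s <+> occ g) h"
  have "inj_on m (occ s <+> occ g)"
    using bij_betw_imp_inj_on[OF \<phi>] by (auto simp: m_def intro!: inj_onI dest: inj_onD)
  moreover have "m ` (occ s <+> occ g) = occ t <+> occ g"
    unfolding m_def Plus_def bij_betw_imp_surj_on[OF \<phi>, symmetric] image_Un image_image map_sum.simps id_apply
    by (rule refl)
  ultimately have m: "bij_betw m (occ s <+> occ g) (occ t <+> occ g)"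
    by (simp add: bij_betw_def)
  have \<psi>: "bij_betw \<psi> (occ (s \<oplus>\<^sub>m g)) (occ (t \<oplus>\<^sub>m g))"
    unfolding \<psi>_def using bij_betw_trans[OF bij_betw_trans[OF bij_betw_inv_into[OF h(1)] m] k(1)]
    by (simp add: comp_assoc)
  have \<psi>h: "\<psi> (h z) = k (m z)" if "z \<in> occ s <+> occ g" for z
    using h(1) that by (simp add: \<psi>_def bij_betw_inv_into_left)
  let ?w = "\<lambda>z. mdist X (fst (h z)) (fst (\<psi> (h z)))"
  have wl: "?w (Inl u) = mdist X (fst u) (fst (\<phi> u))" if "u \<in> occ s" for u
  proof -
    have "\<psi> (h (Inl u)) = k (Inl (\<phi> u))" using \<psi>h[of "Inl u"] that by (auto simp: m_def)
    then show ?thesis using h k that bij_betwE[OF \<phi>] by auto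
  qed
  have wr: "?w (Inr u) = 0" if "u \<in> occ g" for u
  proof -
    have "\<psi> (h (Inr u)) = k (Inr u)" using \<psi>h[of "Inr u"] that by (auto simp: m_def)
    moreover have "fst u \<in> mspace X"
      using that g by (fastforce simp: occ_def cmsets_def)
    ultimately show ?thesis using h k that by auto
  qed
  have "cm_dist X p (s \<oplus>\<^sub>m g) (t \<oplus>\<^sub>m g)
      \<le> lp_size p (occ (s \<oplus>\<^sub>m g)) (\<lambda>u. mdist X (fst u) (fst (\<psi> u)))"
    unfolding cm_dist_def using \<psi> by (auto intro: INF_lower)
  also have "\<dots> = lp_size p (occ s <+> occ g) ?w"
    by (rule lp_size_reindex[OF h(1)])
  also have "\<dots> = lp_size p (Inl ` occ s) ?w"
    by (rule lp_size_neutral) (use wr in \<open>auto simp: Plus_def\<close>)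
  also have "\<dots> = lp_size p (occ s) (\<lambda>u. ?w (Inl u))"
    by (rule lp_size_reindex) (auto simp: bij_betw_def inj_on_def)
  also have "\<dots> = lp_size p (occ s) (\<lambda>u. mdist X (fst u) (fst (\<phi> u)))"
    using wl by (simp add: lp_size_def cong: SUP_cong infsum_cong)
  finally show "cm_dist X p (s \<oplus>\<^sub>m g) (t \<oplus>\<^sub>m g)
      \<le> lp_size p (occ s) (\<lambda>u. mdist X (fst u) (fst (\<phi> u)))" .
qed

lemma rep_dist_le:
  assumes P: "metric_pair (X, A)"
    and s: "(s, s') \<in> diag_rel (X, A)" and t: "(t, t') \<in> diag_rel (X, A)"
  shows "rep_dist (X, A) p s t \<le> rep_dist (X, A) p s' t'"
  unfolding rep_dist_def[of _ _ s' t'] prod.case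
proof (intro INF_greatest)
  fix \<alpha> \<beta> assume ab: "\<alpha> \<in> cmsets A" "\<beta> \<in> cmsets A"
  have A: "cmsets A \<subseteq> cmsets (mspace X)"
    using P closedin_subset[of "mtopology_of X" A] by (simp add: metric_pair_def cmsets_mono)
  obtain c c' where c: "c \<in> cmsets A" "c' \<in> cmsets A" "s \<oplus>\<^sub>m c = s' \<oplus>\<^sub>m c'"
    using s by (auto simp: diag_rel_def)
  obtain e e' where e: "e \<in> cmsets A" "e' \<in> cmsets A" "t \<oplus>\<^sub>m e = t' \<oplus>\<^sub>m e'"
    using t by (auto simp: diag_rel_def)
  have in1: "c \<oplus>\<^sub>m (\<alpha> \<oplus>\<^sub>m e') \<in> cmsets A" and in2: "e \<oplus>\<^sub>m (\<beta> \<oplus>\<^sub>m c') \<in> cmsets A"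
    and in3: "c' \<oplus>\<^sub>m e' \<in> cmsets (mspace X)"
    using ab c e A by (auto intro!: cm_add_in_cmsets)
  have eq1: "s \<oplus>\<^sub>m (c \<oplus>\<^sub>m (\<alpha> \<oplus>\<^sub>m e')) = (s' \<oplus>\<^sub>m \<alpha>) \<oplus>\<^sub>m (c' \<oplus>\<^sub>m e')"
    by (metis c(3) cm_add_assoc cm_add_commute)
  have eq2: "t \<oplus>\<^sub>m (e \<oplus>\<^sub>m (\<beta> \<oplus>\<^sub>m c')) = (t' \<oplus>\<^sub>m \<beta>) \<oplus>\<^sub>m (c' \<oplus>\<^sub>m e')"
    by (metis e(3) cm_add_assoc cm_add_commute)
  have "rep_dist (X, A) p s t
      \<le> cm_dist X p (s \<oplus>\<^sub>m (c \<oplus>\<^sub>m (\<alpha> \<oplus>\<^sub>m e'))) (t \<oplus>\<^sub>m (e \<oplus>\<^sub>m (\<beta> \<oplus>\<^sub>m c')))"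
    unfolding rep_dist_def prod.case by (rule INF_lower2[OF in1], rule INF_lower[OF in2])
  also have "\<dots> \<le> cm_dist X p (s' \<oplus>\<^sub>m \<alpha>) (t' \<oplus>\<^sub>m \<beta>)"
    unfolding eq1 eq2 by (rule cm_dist_add_le[OF in3])
  finally show "rep_dist (X, A) p s t \<le> cm_dist X p (s' \<oplus>\<^sub>m \<alpha>) (t' \<oplus>\<^sub>m \<beta>)" .
qed

lemma diag_dist_class:
  assumes P: "metric_pair (X, A)"
    and s: "s \<in> cmsets (mspace X)" and t: "t \<in> cmsets (mspace X)"
  shows "diag_dist (X, A) p (diag_class (X, A) s) (diag_class (X, A) t) = rep_dist (X, A) p s t"
proof (rule antisym)
  have refl: "u \<in> diag_class (X, A) u" if "u \<in> cmsets (mspace X)" for u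
    using that cm_empty_in_cmsets by (auto simp: diag_class_def diag_rel_def)
  show "diag_dist (X, A) p (diag_class (X, A) s) (diag_class (X, A) t) \<le> rep_dist (X, A) p s t"
    unfolding diag_dist_def by (rule INF_lower2[OF refl[OF s]], rule INF_lower[OF refl[OF t]])
  show "rep_dist (X, A) p s t \<le> diag_dist (X, A) p (diag_class (X, A) s) (diag_class (X, A) t)"
    unfolding diag_dist_def using rep_dist_le[OF P]
    by (intro INF_greatest) (auto simp: diag_class_def)
qed


section \<open>The functor on objects and on morphisms\<close>

definition Dgm_obj :: "ennreal \<Rightarrow> 'a metric \<times> 'a set \<Rightarrow> 'a diagram pointed_space" where
  "Dgm_obj p P = (fin_diagrams P p, diag_dist P p, empty_diagram P)"

text \<open>
  \<open>push Q f \<sigma>\<close> is the union of the classes of the multisets \<open>{f x : x \<in> s}\<close>, where \<open>s\<close> runs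
  through the representatives of \<open>\<sigma>\<close>.  It is a single class, and hence an element of
  \<^term>\<open>diagrams Q\<close>, exactly when the class of the image does not depend on \<open>s\<close>.
\<close>

definition push :: "'a metric \<times> 'a set \<Rightarrow> ('a \<Rightarrow> 'a) \<Rightarrow> 'a diagram \<Rightarrow> 'a diagram" where
  "push Q f \<sigma> = (\<Union>s\<in>\<sigma>. diag_class Q (cm_image f s))"

definition Dgm_map ::
    "ennreal \<Rightarrow> 'a metric \<times> 'a set \<Rightarrow> 'a metric \<times> 'a set \<Rightarrow> ('a \<Rightarrow> 'a) \<Rightarrow> 'a diagram \<Rightarrow> 'a diagram" where
  "Dgm_map p P Q f = restrict (push Q f) (fin_diagrams P p)"

end

theory Submission
  imports Defs
begin

text \<open>
  The distance between diagrams is an infimum of \<open>\<ell>\<^sup>p\<close> sizes of bijections, so every axiom comes from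
  an operation on bijections: inverting one gives symmetry, and composing two gives the triangle
  inequality, because \<open>\<ell>\<^sup>p\<close> sizes satisfy Minkowski's inequality (lemma \<open>lp_size_triangle\<close>).  Only points
  of \<open>A\<close> need care in the composition: a bijection \<open>s + \<alpha> \<rightarrow> t + \<beta>\<close> and a bijection \<open>t + \<gamma> \<rightarrow> u + \<delta>\<close> do
  not fit together, but they do once \<open>\<gamma>\<close> is added to the first and \<open>\<beta>\<close> to the second, at no cost.
  Distances between diagrams of finite distance to the empty one are finite by the triangle inequality.

  A Lipschitz map turns a bijection into one between the images whose weights are larger by a factor
  of at most the Lipschitz constant.  So the induced map is Lipschitz with the same constant
  (lemma \<open>rep_dist_image_le\<close>), and since it fixes the empty diagram, it preserves finiteness.
  It is well defined because forming images commutes with sums of multisets and takes multisets in \<open>A\<close> to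
  multisets in \<open>B\<close>; functoriality is that of images.

  For \<open>p < \<infinity>\<close> points at distance zero are equal (lemma \<open>multiplicity_le_if_rep_dist_0\<close>).
  A diagram of finite distance to the empty one has only finitely many points
  outside any neighbourhood of \<open>A\<close> of positive radius, since each of them costs at least a fixed amount.  Given
  \<open>x \<notin> A\<close>, which has positive distance to \<open>A\<close> because \<open>A\<close> is closed, a small ball around \<open>x\<close> therefore
  meets \<open>A\<close> not at all and the second diagram at most in \<open>x\<close>, so a bijection of sufficiently small size
  must send every copy of \<open>x\<close> to a copy of \<open>x\<close>.  Hence the multiplicities agree outside \<open>A\<close>, which is
  equality of classes.  For \<open>p = \<infinity>\<close> the finiteness may fail, and only a pseudometric remains.

  A countable multiset is handled as the multiset of values of a family over a countable index set.
  Bijections to the set of its occurrences are then built once (lemma \<open>cm_of_bij\<close>), and images and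
  sums of multisets become compositions and disjoint unions of families.
\<close>


section \<open>The size of a family of weights\<close>

text \<open>
  For inequalities between extended numbers it suffices to treat finite bounds, to which the
  characterization of \<open>\<ell>\<^sup>p\<close> sizes by finite sums below applies.
\<close>

lemma ennreal_leI_bounds:
  assumes "\<And>A. 0 \<le> A \<Longrightarrow> b \<le> ennreal A \<Longrightarrow> a \<le> ennreal A"
  shows "a \<le> b"
  using assms by (cases b) auto

text \<open>
  An infinite sum of non-negative terms is the supremum of its finite partial sums.  This reduces all
  estimates of \<open>\<ell>\<^sup>p\<close> sizes for \<open>p < \<infinity>\<close> to finite sums of real numbers.
\<close>

lemma lp_size_le_iff:
  assumes p: "1 \<le> p" "p < \<infinity>" and A: "0 \<le> A"
  shows "lp_size p I w \<le> ennreal A \<longleftrightarrow>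
    (\<forall>F. finite F \<and> F \<subseteq> I \<longrightarrow> (\<Sum>i\<in>F. w i powr enn2real p) \<le> A powr enn2real p)"
proof -
  define r where "r = enn2real p"
  have r: "0 < r"
    using p by (simp add: r_def enn2real_positive_iff) (metis not_gr_zero not_one_le_zero)
  define S where "S = (\<Sum>\<^sub>\<infinity>i\<in>I. ennreal (w i powr r))"
  have S: "S = (SUP F\<in>{F. finite F \<and> F \<subseteq> I}. ennreal (\<Sum>i\<in>F. w i powr r))"
    unfolding S_def by (subst nonneg_infsum_complete) simp_all
  have "lp_size p I w \<le> ennreal A \<longleftrightarrow> S \<le> ennreal (A powr r)"
  proof (cases S)
    case (real s)
    have "s powr (1 / r) \<le> A \<longleftrightarrow> s \<le> A powr r"
    proof
      assume "s powr (1 / r) \<le> A"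
      then have "(s powr (1 / r)) powr r \<le> A powr r" using r by (intro powr_mono2) auto
      then show "s \<le> A powr r" using r real by (simp add: powr_powr)
    next
      assume "s \<le> A powr r"
      then have "s powr (1 / r) \<le> (A powr r) powr (1 / r)" using r real by (intro powr_mono2) auto
      then show "s powr (1 / r) \<le> A" using r A by (simp add: powr_powr)
    qed
    then show ?thesis
      using p real A by (simp add: lp_size_def Let_def flip: r_def S_def) (auto simp: less_top)
  next
    case top
    then show ?thesis
      using p by (simp add: lp_size_def Let_def flip: r_def S_def) (auto simp: less_top top_unique)
  qed
  then show ?thesis
    by (auto simp: S SUP_le_iff r_def[symmetric])
qed

lemma lp_size_cong:
  assumes "\<And>i. i \<in> I \<Longrightarrow> w i = v i"
  shows "lp_size p I w = lp_size p I v"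
  using assms by (simp add: lp_size_def cong: SUP_cong infsum_cong)

lemma lp_size_zero: "lp_size p I (\<lambda>_. 0) = 0"
  by (cases "I = {}") (simp_all add: lp_size_def bot_ennreal)

lemma lp_size_mono:
  assumes p: "1 \<le> p" and w: "\<And>i. i \<in> I \<Longrightarrow> 0 \<le> w i" "\<And>i. i \<in> I \<Longrightarrow> w i \<le> v i"
  shows "lp_size p I w \<le> lp_size p I v"
proof (cases "p = \<infinity>")
  case True
  then show ?thesis
    using w by (auto simp: lp_size_def intro!: SUP_mono ennreal_leI)
next
  case False
  then have fin: "p < \<infinity>" by (simp add: less_top)
  show ?thesis
  proof (rule ennreal_leI_bounds)
    fix A :: real assume A: "0 \<le> A" "lp_size p I v \<le> ennreal A"
    have "(\<Sum>i\<in>F. w i powr enn2real p) \<le> A powr enn2real p" if F: "finite F" "F \<subseteq> I" for F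
    proof -
      have "(\<Sum>i\<in>F. w i powr enn2real p) \<le> (\<Sum>i\<in>F. v i powr enn2real p)"
        using w F by (intro sum_mono powr_mono2) auto
      also have "\<dots> \<le> A powr enn2real p"
        using A F lp_size_le_iff[OF p fin A(1)] by blast
      finally show ?thesis .
    qed
    then show "lp_size p I w \<le> ennreal A"
      using lp_size_le_iff[OF p fin A(1)] by blast
  qed
qed

lemma lp_size_scale_le:
  assumes p: "1 \<le> p" and L: "0 < L"
  shows "lp_size p I (\<lambda>i. L * w i) \<le> ennreal L * lp_size p I w"
proof (cases "p = \<infinity>")
  case True
  then show ?thesis
    using L by (simp add: lp_size_def ennreal_mult' SUP_mult_left_ennreal)
next
  case False
  then have fin: "p < \<infinity>" by (simp add: less_top)
  show ?thesis
  proof (cases "lp_size p I w")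
    case (real B)
    have "(\<Sum>i\<in>F. (L * w i) powr enn2real p) \<le> (L * B) powr enn2real p" if F: "finite F" "F \<subseteq> I" for F
    proof -
      have "(\<Sum>i\<in>F. (L * w i) powr enn2real p) = L powr enn2real p * (\<Sum>i\<in>F. w i powr enn2real p)"
        using L by (simp add: powr_mult sum_distrib_left)
      also have "\<dots> \<le> L powr enn2real p * B powr enn2real p"
        using real F lp_size_le_iff[OF p fin, of B I w] by (intro mult_left_mono) auto
      finally show ?thesis using L real by (simp add: powr_mult)
    qed
    then have "lp_size p I (\<lambda>i. L * w i) \<le> ennreal (L * B)"
      using lp_size_le_iff[OF p fin mult_nonneg_nonneg[OF less_imp_le[OF L] real(1)]] by blast
    then show ?thesis using real L by (simp add: ennreal_mult)
  next
    case top
    then show ?thesis using L by (simp add: ennreal_mult_top)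
  qed
qed

text \<open>
  This is convexity of \<open>x \<mapsto> x\<^sup>r\<close>, extended to the boundary point \<open>0\<close>, where it
  reduces to \<open>c\<^sup>r \<le> c\<close> for \<open>0 \<le> c \<le> 1\<close>.
\<close>

lemma powr_convex_combination_le:
  fixes x y a b r :: real
  assumes r: "1 \<le> r" and xy: "0 \<le> x" "0 \<le> y" and ab: "0 \<le> a" "0 \<le> b" "a + b = 1"
  shows "(a * x + b * y) powr r \<le> a * x powr r + b * y powr r"
proof -
  have shrink: "c powr r \<le> c" if "0 \<le> c" "c \<le> 1" for c :: real
    using that r powr_mono'[of 1 r c] by simp
  consider "x = 0" | "y = 0" | "0 < x" "0 < y" using xy by linarith
  then show ?thesis
  proof cases
    case 1
    then show ?thesis
      using shrink[of b] ab xy r by (simp add: powr_mult mult_right_mono)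
  next
    case 2
    then show ?thesis
      using shrink[of a] ab xy r by (simp add: powr_mult mult_right_mono)
  next
    case 3
    have a: "a = 1 - b" using ab by simp
    show ?thesis
      using convex_onD[OF powr_convex[OF r], of b x y] ab 3 unfolding a by simp
  qed
qed

text \<open>
  The usual proof by convexity: after division by the bounds, \<open>(u + v) / (A + B)\<close> is the convex
  combination of \<open>u / A\<close> and \<open>v / B\<close> with coefficients \<open>A / (A + B)\<close> and \<open>B / (A + B)\<close>.
  If a bound is zero, then its summand vanishes.
\<close>

lemma Minkowski_sum_powr_le:
  fixes u v :: "'i \<Rightarrow> real" and r :: real
  assumes r: "1 \<le> r" and F: "finite F"
    and u: "\<And>i. i \<in> F \<Longrightarrow> 0 \<le> u i" and v: "\<And>i. i \<in> F \<Longrightarrow> 0 \<le> v i"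
    and A: "0 \<le> A" "(\<Sum>i\<in>F. u i powr r) \<le> A powr r"
    and B: "0 \<le> B" "(\<Sum>i\<in>F. v i powr r) \<le> B powr r"
  shows "(\<Sum>i\<in>F. (u i + v i) powr r) \<le> (A + B) powr r"
proof -
  have vanish: "x i = 0" if "i \<in> F" "(\<Sum>i\<in>F. x i powr r) \<le> 0 powr r" for x :: "'i \<Rightarrow> real" and i
  proof -
    have "x i powr r \<le> (\<Sum>i\<in>F. x i powr r)" using F that(1) by (intro member_le_sum) auto
    also have "\<dots> \<le> 0" using that(2) r by simp
    finally show ?thesis by simp
  qed
  consider "A = 0" | "B = 0" | "0 < A" "0 < B" using A B by linarith
  then show ?thesis
  proof cases
    case 1
    then have "u i = 0" if "i \<in> F" for i using vanish[OF that, of u] A by simp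
    then show ?thesis using 1 B by simp
  next
    case 2
    then have "v i = 0" if "i \<in> F" for i using vanish[OF that, of v] B by simp
    then show ?thesis using 2 A by simp
  next
    case 3
    define a b where "a = A / (A + B)" and "b = B / (A + B)"
    have ab: "0 \<le> a" "0 \<le> b" "a + b = 1"
      using 3 by (simp_all add: a_def b_def flip: add_divide_distrib)
    have "((u i + v i) / (A + B)) powr r \<le> a * (u i / A) powr r + b * (v i / B) powr r" if "i \<in> F" for i
    proof -
      have "(u i + v i) / (A + B) = a * (u i / A) + b * (v i / B)"
        using 3 by (simp add: a_def b_def add_divide_distrib)
      then show ?thesis
        using powr_convex_combination_le[OF r _ _ ab, of "u i / A" "v i / B"] 3 u[OF that] v[OF that]
        by simp
    qed
    then have "(\<Sum>i\<in>F. ((u i + v i) / (A + B)) powr r)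
        \<le> (\<Sum>i\<in>F. a * (u i / A) powr r + b * (v i / B) powr r)"
      by (rule sum_mono)
    also have "\<dots> = a * ((\<Sum>i\<in>F. u i powr r) / A powr r) + b * ((\<Sum>i\<in>F. v i powr r) / B powr r)"
      using 3 u v by (simp add: sum.distrib powr_divide sum_distrib_left sum_divide_distrib)
    also have "\<dots> \<le> a * 1 + b * 1"
      using A B 3 ab by (intro add_mono mult_left_mono) (simp_all add: divide_le_eq)
    finally have "(\<Sum>i\<in>F. (u i + v i) powr r) / (A + B) powr r \<le> 1"
      using ab 3 u v by (simp add: powr_divide sum_divide_distrib)
    then show ?thesis using 3 by (simp add: divide_le_eq)
  qed
qed

lemma lp_size_triangle:
  assumes p: "1 \<le> p" and u: "\<And>i. i \<in> I \<Longrightarrow> 0 \<le> u i" and v: "\<And>i. i \<in> I \<Longrightarrow> 0 \<le> v i"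
  shows "lp_size p I (\<lambda>i. u i + v i) \<le> lp_size p I u + lp_size p I v"
proof (cases "p = \<infinity>")
  case True
  then show ?thesis
    using u v by (auto simp: lp_size_def intro!: SUP_least add_mono SUP_upper)
next
  case False
  then have fin: "p < \<infinity>" by (simp add: less_top)
  have r: "1 \<le> enn2real p"
    using p fin enn2real_mono[of 1 p] by simp
  show ?thesis
  proof (cases "lp_size p I u = \<infinity> \<or> lp_size p I v = \<infinity>")
    case False
    then obtain A B where A: "0 \<le> A" "lp_size p I u = ennreal A"
      and B: "0 \<le> B" "lp_size p I v = ennreal B"
      by (cases "lp_size p I u"; cases "lp_size p I v") auto
    have "(\<Sum>i\<in>F. (u i + v i) powr enn2real p) \<le> (A + B) powr enn2real p"
      if F: "finite F" "F \<subseteq> I" for F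
      using r F(1)
    proof (rule Minkowski_sum_powr_le)
      show "(\<Sum>i\<in>F. u i powr enn2real p) \<le> A powr enn2real p"
        using lp_size_le_iff[OF p fin A(1), of I u] A F by simp
      show "(\<Sum>i\<in>F. v i powr enn2real p) \<le> B powr enn2real p"
        using lp_size_le_iff[OF p fin B(1), of I v] B F by simp
    qed (use A B u v F in auto)
    then have "lp_size p I (\<lambda>i. u i + v i) \<le> ennreal (A + B)"
      using lp_size_le_iff[OF p fin add_nonneg_nonneg[OF A(1) B(1)]] by blast
    then show ?thesis using A B by simp
  qed auto
qed

text \<open>
  A matching of small size moves every single point only a little.
\<close>

lemma weight_le_lp_size:
  assumes p: "1 \<le> p" and i: "i \<in> I" and w: "0 \<le> w i"
  shows "ennreal (w i) \<le> lp_size p I w"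
proof (cases "p = \<infinity>")
  case True
  then show ?thesis using i by (auto simp: lp_size_def intro: SUP_upper)
next
  case False
  then have fin: "p < \<infinity>" by (simp add: less_top)
  have r: "1 \<le> enn2real p"
    using p fin enn2real_mono[of 1 p] by simp
  show ?thesis
  proof (rule ennreal_leI_bounds)
    fix A :: real assume A: "0 \<le> A" "lp_size p I w \<le> ennreal A"
    have "(\<Sum>j\<in>{i}. w j powr enn2real p) \<le> A powr enn2real p"
      using lp_size_le_iff[OF p fin A(1), of I w] A i by blast
    then have "w i \<le> A" 
      using powr_less_mono2[of "enn2real p" A "w i"] r A by force
    then show "ennreal (w i) \<le> ennreal A" by (rule ennreal_leI)
  qed
qed

text \<open>
  Each weight that is at least \<open>c\<close> contributes at least \<open>c\<^sup>p\<close> to a finite sum.  For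
  \<open>p = \<infinity>\<close> the constant weight \<open>c\<close> on an infinite set is a counterexample, which is why the distance
  need not separate diagrams in that case.
\<close>

lemma finite_large_weights:
  assumes p: "1 \<le> p" "p < \<infinity>" and w: "lp_size p I w < \<infinity>" and c: "0 < c"
  shows "finite {i \<in> I. c \<le> w i}"
proof (rule ccontr)
  let ?J = "{i \<in> I. c \<le> w i}" and ?r = "enn2real p"
  assume inf: "infinite ?J"
  obtain A where A: "0 \<le> A" "lp_size p I w = ennreal A"
    using w by (cases "lp_size p I w") auto
  have cr: "0 < c powr ?r" using c by simp
  obtain n where n: "A powr ?r < of_nat n * c powr ?r"
    using reals_Archimedean3[OF cr] by blast
  obtain F where F: "finite F" "card F = n" "F \<subseteq> ?J"
    using infinite_arbitrarily_large[OF inf] by blast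
  have "of_nat n * c powr ?r = (\<Sum>i\<in>F. c powr ?r)" using F by simp
  also have "\<dots> \<le> (\<Sum>i\<in>F. w i powr ?r)"
    using F c by (intro sum_mono powr_mono2) auto
  also have "\<dots> \<le> A powr ?r"
    using lp_size_le_iff[OF p A(1), of I w] A F by auto
  finally show False using n by simp
qed


section \<open>Countable multisets as families\<close>

text \<open>
  The multiset of values of a family.  The multiplicities count indices only up to a single
  infinity, so this is the multiset of values in the intended sense when the index set is countable.
\<close>

definition cm_of :: "'i set \<Rightarrow> ('i \<Rightarrow> 'a) \<Rightarrow> 'a cmset" where
  "cm_of I g = (\<lambda>y. ecard {i \<in> I. g i = y})"

lemma cm_image_eq_cm_of: "cm_image f s = cm_of (occ s) (f \<circ> fst)"
  by (simp add: cm_image_def cm_of_def)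

lemma ecard_bij_betw: "bij_betw h S T \<Longrightarrow> ecard S = ecard T"
  by (simp add: ecard_def bij_betw_finite bij_betw_same_card)

lemma ecard_mono: "S \<subseteq> T \<Longrightarrow> ecard S \<le> ecard T"
  by (auto simp: ecard_def card_mono finite_subset)

lemma ecard_below: "ecard {n. enat n < m} = m"
  by (cases m) (auto simp: ecard_def simp flip: lessThan_def)

lemma ecard_Plus: "ecard (S <+> T) = ecard S + ecard T"
  by (auto simp: ecard_def card_Plus finite_Plus_iff)

lemma bij_betw_below_ecard:
  assumes "countable S"
  shows "\<exists>h. bij_betw h S {n. enat n < ecard S}"
proof (cases "finite S")
  case True
  then show ?thesis
    using ex_bij_betw_finite_nat[OF True] by (auto simp: ecard_def simp: atLeast0LessThan simp flip: lessThan_def)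
next
  case False
  then show ?thesis
    using to_nat_on_infinite[OF assms] by (auto simp: ecard_def)
qed

text \<open>
  The indices of a countable family correspond to the occurrences of its multiset of values: in each
  fibre both sides are countable and have the same number of elements.
\<close>

lemma cm_of_bij:
  assumes I: "countable I"
  obtains h where "bij_betw h I (occ (cm_of I g))" "\<And>i. i \<in> I \<Longrightarrow> fst (h i) = g i"
proof -
  have "\<forall>y. \<exists>k. bij_betw k {i \<in> I. g i = y} {n. enat n < cm_of I g y}"
    unfolding cm_of_def using I
    by (intro allI bij_betw_below_ecard) (auto intro: countable_subset)
  from choice[OF this] obtain k
    where k: "\<And>y. bij_betw (k y) {i \<in> I. g i = y} {n. enat n < cm_of I g y}" by blast
  define h where "h i = (g i, k (g i) i)" for i
  have "inj_on h I"
  proof (rule inj_onI)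
    fix i j assume ij: "i \<in> I" "j \<in> I" "h i = h j"
    then show "i = j"
      using bij_betw_imp_inj_on[OF k[of "g i"]] by (auto simp: h_def dest: inj_onD)
  qed
  moreover have "h ` I = occ (cm_of I g)"
  proof (intro set_eqI iffI)
    fix u assume "u \<in> h ` I"
    then show "u \<in> occ (cm_of I g)"
      using bij_betwE[OF k] by (auto simp: h_def occ_def)
  next
    fix u assume "u \<in> occ (cm_of I g)"
    then obtain y n where u: "u = (y, n)" "n \<in> {n. enat n < cm_of I g y}"
      by (auto simp: occ_def)
    then obtain i where "i \<in> I" "g i = y" "n = k y i"
      using bij_betw_imp_surj_on[OF k[of y]] by blast
    then show "u \<in> h ` I" using u by (auto simp: h_def)
  qed
  ultimately have "bij_betw h I (occ (cm_of I g))" by (simp add: bij_betw_def)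
  then show thesis by (rule that) (simp add: h_def)
qed

lemma cm_of_reindex:
  assumes "bij_betw h I J" and "\<And>i. i \<in> I \<Longrightarrow> g i = f (h i)"
  shows "cm_of I g = cm_of J f"
proof
  fix y
  have "bij_betw h {i \<in> I. g i = y} {j \<in> J. f j = y}"
    using assms unfolding bij_betw_def by (auto simp: inj_on_def)
  then show "cm_of I g y = cm_of J f y"
    unfolding cm_of_def by (rule ecard_bij_betw)
qed

lemma cm_of_cong: "(\<And>i. i \<in> I \<Longrightarrow> g i = f i) \<Longrightarrow> cm_of I g = cm_of I f"
  by (rule cm_of_reindex[of id]) auto

lemma cm_of_Plus: "cm_of (I <+> J) f = cm_of I (f \<circ> Inl) \<oplus>\<^sub>m cm_of J (f \<circ> Inr)"
proof
  fix y
  have "{i \<in> I <+> J. f i = y} = {i \<in> I. f (Inl i) = y} <+> {j \<in> J. f (Inr j) = y}"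
    by auto
  then show "cm_of (I <+> J) f y = (cm_of I (f \<circ> Inl) \<oplus>\<^sub>m cm_of J (f \<circ> Inr)) y"
    by (simp add: cm_of_def cm_add_def ecard_Plus)
qed

lemma cm_of_occ: "cm_of (occ s) fst = s"
proof
  fix y
  have "bij_betw snd {u \<in> occ s. fst u = y} {n. enat n < s y}"
    by (rule bij_betwI[where g = "Pair y"]) (auto simp: occ_def)
  from ecard_bij_betw[OF this] show "cm_of (occ s) fst y = s y"
    unfolding cm_of_def ecard_below .
qed

lemma countable_occ:
  assumes "s \<in> cmsets Y"
  shows "countable (occ s)"
proof (rule countable_subset)
  show "occ s \<subseteq> {x. s x \<noteq> 0} \<times> UNIV" by (auto simp: occ_def)
  show "countable ({x. s x \<noteq> 0} \<times> (UNIV :: nat set))" using assms by (simp add: cmsets_def)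
qed

lemma fst_occ_in:
  assumes "s \<in> cmsets Y" "u \<in> occ s"
  shows "fst u \<in> Y"
  using assms by (fastforce simp: occ_def cmsets_def)

lemma cm_image_cm_of:
  assumes "countable I"
  shows "cm_image f (cm_of I g) = cm_of I (f \<circ> g)"
proof -
  obtain h where "bij_betw h I (occ (cm_of I g))" "\<And>i. i \<in> I \<Longrightarrow> fst (h i) = g i"
    using cm_of_bij[OF assms, of g] by blast
  then show ?thesis
    unfolding cm_image_eq_cm_of by (intro cm_of_reindex[symmetric]) auto
qed

lemma cm_image_comp:
  assumes "s \<in> cmsets Y"
  shows "cm_image g (cm_image f s) = cm_image (g \<circ> f) s"
  using cm_image_cm_of[OF countable_occ[OF assms], of g "f \<circ> fst"]
  by (simp add: cm_image_eq_cm_of comp_assoc)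

lemma cm_image_cong:
  assumes "s \<in> cmsets Y" "\<And>x. x \<in> Y \<Longrightarrow> f x = g x"
  shows "cm_image f s = cm_image g s"
  unfolding cm_image_eq_cm_of using assms(2) fst_occ_in[OF assms(1)] by (intro cm_of_cong) simp

lemma cm_image_id: "cm_image id s = s"
  by (simp add: cm_image_eq_cm_of cm_of_occ)

lemma cm_image_empty: "cm_image f cm_empty = cm_empty"
  by (simp add: cm_image_def cm_empty_def occ_def ecard_def zero_enat_def)

text \<open>
  An occurrence of a sum is an occurrence of one of the summands.
\<close>

lemma cm_image_add: "cm_image f (s \<oplus>\<^sub>m t) = cm_image f s \<oplus>\<^sub>m cm_image f t"
proof -
  obtain h where h: "bij_betw h (occ s <+> occ t) (occ (s \<oplus>\<^sub>m t))"
    "\<And>u. u \<in> occ s \<Longrightarrow> fst (h (Inl u)) = fst u" "\<And>u. u \<in> occ t \<Longrightarrow> fst (h (Inr u)) = fst u"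
    by (rule occ_add_bij[of s t], rule that, simp_all)
  have "cm_image f (s \<oplus>\<^sub>m t) = cm_of (occ s <+> occ t) (\<lambda>z. f (fst (h z)))"
    unfolding cm_image_eq_cm_of by (rule cm_of_reindex[OF h(1), symmetric]) simp
  also have "\<dots> = cm_of (occ s) (f \<circ> fst) \<oplus>\<^sub>m cm_of (occ t) (f \<circ> fst)"
    unfolding cm_of_Plus using h by (intro arg_cong2[where f = cm_add] cm_of_cong) auto
  finally show ?thesis by (simp add: cm_image_eq_cm_of)
qed

lemma cm_image_in_cmsets:
  assumes s: "s \<in> cmsets A" and f: "f ` A \<subseteq> B"
  shows "cm_image f s \<in> cmsets B"
proof -
  have "{y. cm_image f s y \<noteq> 0} \<subseteq> f ` {x. s x \<noteq> 0}"
  proof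
    fix y assume "y \<in> {y. cm_image f s y \<noteq> 0}"
    then have "{u \<in> occ s. f (fst u) = y} \<noteq> {}"
      by (auto simp only: cm_image_def ecard_def zero_enat_def mem_Collect_eq finite.emptyI card.empty if_True)
    then obtain x n where "enat n < s x" "y = f x"
      by (auto simp: occ_def)
    then show "y \<in> f ` {x. s x \<noteq> 0}" by auto
  qed
  moreover have "countable (f ` {x. s x \<noteq> 0})" "f ` {x. s x \<noteq> 0} \<subseteq> B"
    using s f by (auto simp: cmsets_def)
  ultimately show ?thesis by (auto simp: cmsets_def intro: countable_subset)
qed


section \<open>The matching distance\<close>

text \<open>
  Upper bounds for a sum of two infima are obtained by choosing nearly optimal elements.
\<close>

lemma ennreal_le_add_if_less:
  fixes x y z :: ennreal
  assumes "\<And>a b. y < a \<Longrightarrow> z < b \<Longrightarrow> x \<le> a + b"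
  shows "x \<le> y + z"
proof (rule ennreal_le_epsilon)
  fix e :: real assume e: "0 < e" and fin: "y + z < top"
  have lt: "r < r + ennreal (e / 2)" if "r < top" for r
    using that e by (cases r) (auto simp: ennreal_less_iff simp flip: ennreal_plus)
  have "x \<le> (y + ennreal (e / 2)) + (z + ennreal (e / 2))"
    using fin by (intro assms lt) auto
  also have "\<dots> = y + z + (ennreal (e / 2) + ennreal (e / 2))"
    by (simp only: add_ac)
  also have "ennreal (e / 2) + ennreal (e / 2) = ennreal e"
    using e by (simp flip: ennreal_plus)
  finally show "x \<le> y + z + ennreal e" .
qed

lemma ennreal_le_mult_INF:
  fixes f :: "'i \<Rightarrow> ennreal"
  assumes L: "0 < L" and le: "\<And>i. i \<in> I \<Longrightarrow> x \<le> ennreal L * f i"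
  shows "x \<le> ennreal L * (INF i\<in>I. f i)"
proof -
  have "x / ennreal L \<le> (INF i\<in>I. f i)"
    using L le by (intro INF_greatest divide_le_posI_ennreal) (auto simp: mult.commute)
  then have "ennreal L * (x / ennreal L) \<le> ennreal L * (INF i\<in>I. f i)"
    by (rule mult_left_mono) simp
  moreover have "ennreal L * (x / ennreal L) = x"
    using L by (simp add: ennreal_times_divide ennreal_mult_divide_eq mult.commute[of _ x])
  ultimately show ?thesis by simp
qed

lemma cm_dist_le:
  "bij_betw \<phi> (occ s) (occ t) \<Longrightarrow>
    cm_dist X p s t \<le> lp_size p (occ s) (\<lambda>u. mdist X (fst u) (fst (\<phi> u)))"
  unfolding cm_dist_def by (rule INF_lower) simp

text \<open>
  Any two families over the same index set give a matching of their multisets of values: the indices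
  are in bijection with the occurrences on both sides.
\<close>

lemma cm_dist_cm_of_le:
  assumes I: "countable I"
  shows "cm_dist X p (cm_of I g) (cm_of I h) \<le> lp_size p I (\<lambda>i. mdist X (g i) (h i))"
proof -
  obtain a where a: "bij_betw a I (occ (cm_of I g))" "\<And>i. i \<in> I \<Longrightarrow> fst (a i) = g i"
    using cm_of_bij[OF I, of g] by blast
  obtain b where b: "bij_betw b I (occ (cm_of I h))" "\<And>i. i \<in> I \<Longrightarrow> fst (b i) = h i"
    using cm_of_bij[OF I, of h] by blast
  define \<phi> where "\<phi> = b \<circ> inv_into I a"
  have "bij_betw \<phi> (occ (cm_of I g)) (occ (cm_of I h))"
    unfolding \<phi>_def using bij_betw_trans[OF bij_betw_inv_into[OF a(1)] b(1)] .
  then have "cm_dist X p (cm_of I g) (cm_of I h)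
      \<le> lp_size p (occ (cm_of I g)) (\<lambda>u. mdist X (fst u) (fst (\<phi> u)))"
    by (rule cm_dist_le)
  also have "\<dots> = lp_size p I (\<lambda>i. mdist X (fst (a i)) (fst (\<phi> (a i))))"
    by (rule lp_size_reindex[OF a(1)])
  also have "\<dots> = lp_size p I (\<lambda>i. mdist X (g i) (h i))"
    using a b by (intro lp_size_cong) (simp add: \<phi>_def bij_betw_inv_into_left)
  finally show ?thesis .
qed

lemma cm_dist_refl:
  assumes "s \<in> cmsets (mspace X)"
  shows "cm_dist X p s s = 0"
proof -
  have "cm_dist X p s s \<le> lp_size p (occ s) (\<lambda>u. mdist X (fst u) (fst u))"
    using cm_dist_cm_of_le[OF countable_occ[OF assms], of X p fst fst] by (simp add: cm_of_occ)
  also have "\<dots> = lp_size p (occ s) (\<lambda>_. 0)"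
    using fst_occ_in[OF assms] by (intro lp_size_cong) simp
  finally show ?thesis by (simp add: lp_size_zero)
qed

lemma cm_dist_sym_le:
  "cm_dist X p t s \<le> cm_dist X p s t"
  unfolding cm_dist_def[of X p s t]
proof (rule INF_greatest)
  fix \<phi> assume "\<phi> \<in> {\<phi>. bij_betw \<phi> (occ s) (occ t)}"
  then have \<phi>: "bij_betw \<phi> (occ s) (occ t)" by simp
  let ?\<psi> = "inv_into (occ s) \<phi>"
  have "cm_dist X p t s \<le> lp_size p (occ t) (\<lambda>v. mdist X (fst v) (fst (?\<psi> v)))"
    by (rule cm_dist_le[OF bij_betw_inv_into[OF \<phi>]])
  also have "\<dots> = lp_size p (occ s) (\<lambda>u. mdist X (fst (\<phi> u)) (fst (?\<psi> (\<phi> u))))"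
    by (rule lp_size_reindex[OF \<phi>])
  also have "\<dots> = lp_size p (occ s) (\<lambda>u. mdist X (fst u) (fst (\<phi> u)))"
    using \<phi> by (intro lp_size_cong) (simp add: bij_betw_inv_into_left mdist_commute)
  finally show "cm_dist X p t s \<le> lp_size p (occ s) (\<lambda>u. mdist X (fst u) (fst (\<phi> u)))" .
qed

lemma cm_dist_triangle:
  assumes p: "1 \<le> p"
    and s: "s \<in> cmsets (mspace X)" and t: "t \<in> cmsets (mspace X)" and u: "u \<in> cmsets (mspace X)"
  shows "cm_dist X p s u \<le> cm_dist X p s t + cm_dist X p t u"
proof -
  let ?c = "\<lambda>a \<phi>. lp_size p (occ a) (\<lambda>x. mdist X (fst x) (fst (\<phi> x)))"
  have *: "cm_dist X p s u \<le> ?c s \<phi> + ?c t \<psi>"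
    if \<phi>: "bij_betw \<phi> (occ s) (occ t)" and \<psi>: "bij_betw \<psi> (occ t) (occ u)" for \<phi> \<psi>
  proof -
    have "cm_dist X p s u \<le> ?c s (\<psi> \<circ> \<phi>)"
      by (rule cm_dist_le[OF bij_betw_trans[OF \<phi> \<psi>]])
    also have "\<dots> \<le> lp_size p (occ s)
        (\<lambda>x. mdist X (fst x) (fst (\<phi> x)) + mdist X (fst (\<phi> x)) (fst (\<psi> (\<phi> x))))"
      using bij_betwE[OF \<phi>] bij_betwE[OF \<psi>]
      by (intro lp_size_mono[OF p])
        (simp_all add: mdist_triangle fst_occ_in[OF s] fst_occ_in[OF t] fst_occ_in[OF u])
    also have "\<dots> \<le> ?c s \<phi> + lp_size p (occ s) (\<lambda>x. mdist X (fst (\<phi> x)) (fst (\<psi> (\<phi> x))))"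
      by (rule lp_size_triangle[OF p]) simp_all
    also have "lp_size p (occ s) (\<lambda>x. mdist X (fst (\<phi> x)) (fst (\<psi> (\<phi> x)))) = ?c t \<psi>"
      by (rule lp_size_reindex[OF \<phi>, symmetric])
    finally show ?thesis .
  qed
  show ?thesis
  proof (rule ennreal_le_add_if_less)
    fix a b assume "cm_dist X p s t < a" "cm_dist X p t u < b"
    then obtain \<phi> \<psi> where "bij_betw \<phi> (occ s) (occ t)" "?c s \<phi> < a"
      and "bij_betw \<psi> (occ t) (occ u)" "?c t \<psi> < b"
      by (auto simp: cm_dist_def INF_less_iff)
    then show "cm_dist X p s u \<le> a + b"
      using *[of \<phi> \<psi>] by (meson add_mono less_imp_le order_trans)
  qed
qed

text \<open>
  A matching of \<open>s\<close> and \<open>t\<close> presents the two images as families over the occurrences of \<open>s\<close>, and the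
  weights of this pair of families are at most \<open>L\<close> times the original ones.
\<close>

lemma cm_dist_image_le:
  assumes p: "1 \<le> p" and L: "0 < L"
    and f: "\<And>x y. x \<in> mspace X \<Longrightarrow> y \<in> mspace X \<Longrightarrow> mdist Y (f x) (f y) \<le> L * mdist X x y"
    and s: "s \<in> cmsets (mspace X)" and t: "t \<in> cmsets (mspace X)"
  shows "cm_dist Y p (cm_image f s) (cm_image f t) \<le> ennreal L * cm_dist X p s t"
proof -
  have "cm_dist Y p (cm_image f s) (cm_image f t)
      \<le> ennreal L * lp_size p (occ s) (\<lambda>u. mdist X (fst u) (fst (\<phi> u)))"
    if \<phi>: "bij_betw \<phi> (occ s) (occ t)" for \<phi>
  proof -
    have "cm_image f t = cm_of (occ s) (f \<circ> fst \<circ> \<phi>)"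
      unfolding cm_image_eq_cm_of by (rule cm_of_reindex[OF \<phi>, symmetric]) simp
    then have "cm_dist Y p (cm_image f s) (cm_image f t)
        \<le> lp_size p (occ s) (\<lambda>u. mdist Y (f (fst u)) (f (fst (\<phi> u))))"
      using cm_dist_cm_of_le[OF countable_occ[OF s], of Y p "f \<circ> fst" "f \<circ> fst \<circ> \<phi>"]
      by (simp add: cm_image_eq_cm_of)
    also have "\<dots> \<le> lp_size p (occ s) (\<lambda>u. L * mdist X (fst u) (fst (\<phi> u)))"
      using fst_occ_in[OF s] fst_occ_in[OF t] bij_betwE[OF \<phi>]
      by (intro lp_size_mono[OF p] f) auto
    also have "\<dots> \<le> ennreal L * lp_size p (occ s) (\<lambda>u. mdist X (fst u) (fst (\<phi> u)))"
      by (rule lp_size_scale_le[OF p L])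
    finally show ?thesis .
  qed
  then show ?thesis
    unfolding cm_dist_def[of X p s t] by (intro ennreal_le_mult_INF[OF L]) auto
qed


section \<open>Persistence diagrams as classes\<close>

lemma metric_pair_subset: "metric_pair (X, A) \<Longrightarrow> A \<subseteq> mspace X"
  using closedin_subset[of "mtopology_of X" A] by (simp add: metric_pair_def)

lemma metric_pair_cmsets: "metric_pair (X, A) \<Longrightarrow> s \<in> cmsets A \<Longrightarrow> s \<in> cmsets (mspace X)"
  using metric_pair_subset cmsets_mono by blast

lemma equiv_diag_rel: "equiv (cmsets (mspace X)) (diag_rel (X, A))"
proof (rule equivI)
  show "diag_rel (X, A) \<subseteq> cmsets (mspace X) \<times> cmsets (mspace X)"
    by (auto simp: diag_rel_def)
  show "refl_on (cmsets (mspace X)) (diag_rel (X, A))"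
    using cm_empty_in_cmsets by (auto simp: diag_rel_def refl_on_def)
  show "sym (diag_rel (X, A))"
    by (auto simp: diag_rel_def sym_def) metis
  show "trans (diag_rel (X, A))"
  proof (rule transI)
    fix s t u assume "(s, t) \<in> diag_rel (X, A)" "(t, u) \<in> diag_rel (X, A)"
    then obtain a b c d where *: "s \<in> cmsets (mspace X)" "u \<in> cmsets (mspace X)"
      "a \<in> cmsets A" "b \<in> cmsets A" "c \<in> cmsets A" "d \<in> cmsets A"
      "s \<oplus>\<^sub>m a = t \<oplus>\<^sub>m b" "t \<oplus>\<^sub>m c = u \<oplus>\<^sub>m d"
      by (auto simp: diag_rel_def)
    have "s \<oplus>\<^sub>m (a \<oplus>\<^sub>m c) = u \<oplus>\<^sub>m (d \<oplus>\<^sub>m b)"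
      using *(7,8) by (metis cm_add_assoc cm_add_commute)
    then show "(s, u) \<in> diag_rel (X, A)"
      using * cm_add_in_cmsets by (auto simp: diag_rel_def) blast
  qed
qed

lemma diag_class_eq_iff:
  assumes "s \<in> cmsets (mspace X)" "t \<in> cmsets (mspace X)"
  shows "diag_class (X, A) s = diag_class (X, A) t \<longleftrightarrow> (s, t) \<in> diag_rel (X, A)"
  unfolding diag_class_def using equiv_diag_rel assms by (rule eq_equiv_class_iff)

lemma diagramsE:
  assumes "\<sigma> \<in> diagrams (X, A)"
  obtains s where "s \<in> cmsets (mspace X)" "\<sigma> = diag_class (X, A) s"
  using assms by (auto simp: diagrams_def diag_class_def elim: quotientE)

lemma diag_class_in_diagrams:
  "s \<in> cmsets (mspace X) \<Longrightarrow> diag_class (X, A) s \<in> diagrams (X, A)"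
  by (auto simp: diagrams_def diag_class_def intro: quotientI)

lemma rep_dist_refl:
  assumes "metric_pair (X, A)" "s \<in> cmsets (mspace X)"
  shows "rep_dist (X, A) p s s = 0"
proof -
  have "rep_dist (X, A) p s s \<le> cm_dist X p (s \<oplus>\<^sub>m cm_empty) (s \<oplus>\<^sub>m cm_empty)"
    unfolding rep_dist_def prod.case
    by (rule INF_lower2[OF cm_empty_in_cmsets], rule INF_lower[OF cm_empty_in_cmsets])
  also have "\<dots> = 0"
    by (rule cm_dist_refl) (intro cm_add_in_cmsets assms(2) cm_empty_in_cmsets)
  finally show ?thesis by simp
qed

lemma rep_dist_sym: "rep_dist (X, A) p s t = rep_dist (X, A) p t s"
proof -
  have "rep_dist (X, A) p s t \<le> rep_dist (X, A) p t s" for s t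
    unfolding rep_dist_def prod.case
    by (subst INF_commute) (intro INF_mono' cm_dist_sym_le)
  then show ?thesis by (intro antisym)
qed

lemma rep_dist_lessE:
  assumes "rep_dist (X, A) p s t < c"
  obtains \<alpha> \<beta> where "\<alpha> \<in> cmsets A" "\<beta> \<in> cmsets A" "cm_dist X p (s \<oplus>\<^sub>m \<alpha>) (t \<oplus>\<^sub>m \<beta>) < c"
  using assms by (auto simp: rep_dist_def INF_less_iff)

text \<open>
  Matchings of \<open>s + \<alpha>\<close> with \<open>t + \<beta>\<close> and of \<open>t + \<gamma>\<close> with \<open>u + \<delta>\<close> become composable after adding \<open>\<gamma>\<close>
  to both sides of the first and \<open>\<beta>\<close> to both sides of the second, and this does not increase their
  size, since the added points can be matched with themselves.
\<close>

lemma rep_dist_triangle: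
  assumes P: "metric_pair (X, A)" and p: "1 \<le> p"
    and s: "s \<in> cmsets (mspace X)" and t: "t \<in> cmsets (mspace X)" and u: "u \<in> cmsets (mspace X)"
  shows "rep_dist (X, A) p s u \<le> rep_dist (X, A) p s t + rep_dist (X, A) p t u"
proof (rule ennreal_le_add_if_less)
  fix a b assume "rep_dist (X, A) p s t < a" "rep_dist (X, A) p t u < b"
  then obtain \<alpha> \<beta> \<gamma> \<delta> where ab: "\<alpha> \<in> cmsets A" "\<beta> \<in> cmsets A" "cm_dist X p (s \<oplus>\<^sub>m \<alpha>) (t \<oplus>\<^sub>m \<beta>) < a"
    and cd: "\<gamma> \<in> cmsets A" "\<delta> \<in> cmsets A" "cm_dist X p (t \<oplus>\<^sub>m \<gamma>) (u \<oplus>\<^sub>m \<delta>) < b"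
    by (elim rep_dist_lessE)
  note in_X = metric_pair_cmsets[OF P]
  have "rep_dist (X, A) p s u \<le> cm_dist X p (s \<oplus>\<^sub>m (\<alpha> \<oplus>\<^sub>m \<gamma>)) (u \<oplus>\<^sub>m (\<delta> \<oplus>\<^sub>m \<beta>))"
    unfolding rep_dist_def prod.case using ab cd
    by (intro INF_lower2[of "\<alpha> \<oplus>\<^sub>m \<gamma>"] INF_lower2[of "\<delta> \<oplus>\<^sub>m \<beta>"] cm_add_in_cmsets order_refl)
  also have "\<dots> \<le> cm_dist X p (s \<oplus>\<^sub>m (\<alpha> \<oplus>\<^sub>m \<gamma>)) (t \<oplus>\<^sub>m (\<beta> \<oplus>\<^sub>m \<gamma>))
      + cm_dist X p (t \<oplus>\<^sub>m (\<beta> \<oplus>\<^sub>m \<gamma>)) (u \<oplus>\<^sub>m (\<delta> \<oplus>\<^sub>m \<beta>))"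
    using ab cd s t u by (intro cm_dist_triangle[OF p]) (simp_all add: cm_add_in_cmsets in_X)
  also have "\<dots> \<le> cm_dist X p (s \<oplus>\<^sub>m \<alpha>) (t \<oplus>\<^sub>m \<beta>) + cm_dist X p (t \<oplus>\<^sub>m \<gamma>) (u \<oplus>\<^sub>m \<delta>)"
  proof (rule add_mono)
    show "cm_dist X p (s \<oplus>\<^sub>m (\<alpha> \<oplus>\<^sub>m \<gamma>)) (t \<oplus>\<^sub>m (\<beta> \<oplus>\<^sub>m \<gamma>)) \<le> cm_dist X p (s \<oplus>\<^sub>m \<alpha>) (t \<oplus>\<^sub>m \<beta>)"
      using cm_dist_add_le[OF in_X[OF cd(1)], of p "s \<oplus>\<^sub>m \<alpha>" "t \<oplus>\<^sub>m \<beta>"] by (simp add: cm_add_assoc)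
    show "cm_dist X p (t \<oplus>\<^sub>m (\<beta> \<oplus>\<^sub>m \<gamma>)) (u \<oplus>\<^sub>m (\<delta> \<oplus>\<^sub>m \<beta>)) \<le> cm_dist X p (t \<oplus>\<^sub>m \<gamma>) (u \<oplus>\<^sub>m \<delta>)"
      using cm_dist_add_le[OF in_X[OF ab(2)], of p "t \<oplus>\<^sub>m \<gamma>" "u \<oplus>\<^sub>m \<delta>"]
      by (simp add: cm_add_assoc cm_add_commute[of \<beta>])
  qed
  also have "\<dots> \<le> a + b"
    using ab cd by (intro add_mono less_imp_le)
  finally show "rep_dist (X, A) p s u \<le> a + b" .
qed

text \<open>
  The image of a multiset in \<open>A\<close> is a multiset in \<open>B\<close>, so it may be added on the side of the images.
\<close>

lemma rep_dist_image_le: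
  assumes P: "metric_pair (X, A)" and p: "1 \<le> p" and L: "0 < L"
    and f: "\<And>x y. x \<in> mspace X \<Longrightarrow> y \<in> mspace X \<Longrightarrow> mdist Y (f x) (f y) \<le> L * mdist X x y"
    and fA: "f ` A \<subseteq> B"
    and s: "s \<in> cmsets (mspace X)" and t: "t \<in> cmsets (mspace X)"
  shows "rep_dist (Y, B) p (cm_image f s) (cm_image f t) \<le> ennreal L * rep_dist (X, A) p s t"
proof -
  have "rep_dist (Y, B) p (cm_image f s) (cm_image f t) \<le> ennreal L * cm_dist X p (s \<oplus>\<^sub>m \<alpha>) (t \<oplus>\<^sub>m \<beta>)"
    if ab: "\<alpha> \<in> cmsets A" "\<beta> \<in> cmsets A" for \<alpha> \<beta>
  proof -
    have "rep_dist (Y, B) p (cm_image f s) (cm_image f t)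
        \<le> cm_dist Y p (cm_image f s \<oplus>\<^sub>m cm_image f \<alpha>) (cm_image f t \<oplus>\<^sub>m cm_image f \<beta>)"
      unfolding rep_dist_def prod.case using ab fA
      by (intro INF_lower2[of "cm_image f \<alpha>"] INF_lower2[of "cm_image f \<beta>"] cm_image_in_cmsets order_refl)
    also have "\<dots> \<le> ennreal L * cm_dist X p (s \<oplus>\<^sub>m \<alpha>) (t \<oplus>\<^sub>m \<beta>)"
      unfolding cm_image_add[symmetric] using ab s t
      by (intro cm_dist_image_le[OF p L f]) (simp_all add: cm_add_in_cmsets metric_pair_cmsets[OF P])
    finally show ?thesis .
  qed
  then show ?thesis
    unfolding rep_dist_def[of "(X, A)"] prod.case by (intro ennreal_le_mult_INF[OF L])
qed


section \<open>Diagrams at distance zero\<close>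

lemma occ_add_superset: "occ s \<subseteq> occ (s \<oplus>\<^sub>m t)"
  by (auto simp: occ_def cm_add_def intro: order_less_le_trans)

lemma cm_dist_lessE:
  assumes "cm_dist X p s t < c"
  obtains \<phi> where "bij_betw \<phi> (occ s) (occ t)"
    "lp_size p (occ s) (\<lambda>u. mdist X (fst u) (fst (\<phi> u))) < c"
  using assms by (auto simp: cm_dist_def INF_less_iff)

text \<open>
  A matching with a multiset in \<open>A\<close> moves each point by at least its distance to \<open>A\<close>, so a matching of
  finite size leaves room for only finitely many points that are far away from \<open>A\<close>.
\<close>

lemma finite_far_occurrences:
  assumes p: "1 \<le> p" "p < \<infinity>"
    and fin: "rep_dist (X, A) p s cm_empty < \<infinity>" and \<delta>: "0 < \<delta>"
  shows "finite {u \<in> occ s. \<forall>a\<in>A. \<delta> \<le> mdist X (fst u) a}"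
proof -
  obtain \<alpha> \<beta> where "\<alpha> \<in> cmsets A" and \<beta>: "\<beta> \<in> cmsets A"
    and "cm_dist X p (s \<oplus>\<^sub>m \<alpha>) (cm_empty \<oplus>\<^sub>m \<beta>) < \<infinity>"
    using fin by (rule rep_dist_lessE)
  moreover have "cm_empty \<oplus>\<^sub>m \<beta> = \<beta>" by (simp add: cm_empty_def cm_add_def)
  ultimately obtain \<phi> where \<phi>: "bij_betw \<phi> (occ (s \<oplus>\<^sub>m \<alpha>)) (occ \<beta>)"
    "lp_size p (occ (s \<oplus>\<^sub>m \<alpha>)) (\<lambda>u. mdist X (fst u) (fst (\<phi> u))) < \<infinity>"
    by (metis cm_dist_lessE)
  have "finite {u \<in> occ (s \<oplus>\<^sub>m \<alpha>). \<delta> \<le> mdist X (fst u) (fst (\<phi> u))}"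
    by (rule finite_large_weights[OF p \<phi>(2) \<delta>])
  then show ?thesis
  proof (rule rev_finite_subset)
    show "{u \<in> occ s. \<forall>a\<in>A. \<delta> \<le> mdist X (fst u) a}
        \<subseteq> {u \<in> occ (s \<oplus>\<^sub>m \<alpha>). \<delta> \<le> mdist X (fst u) (fst (\<phi> u))}"
      using occ_add_superset[of s \<alpha>] bij_betwE[OF \<phi>(1)] fst_occ_in[OF \<beta>] by blast
  qed
qed

text \<open>
  Let \<open>\<delta>\<close> be a positive lower bound for the distance of \<open>x\<close> to \<open>A\<close>.  The points of \<open>t\<close> at distance at
  least \<open>\<delta> / 2\<close> from \<open>A\<close> form a finite set, so those different from \<open>x\<close> stay away from \<open>x\<close> by some
  \<open>\<epsilon> \<le> \<delta> / 2\<close>.  A matching of size less than \<open>\<epsilon>\<close> sends a copy of \<open>x\<close> to a point of distance less than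
  \<open>\<epsilon>\<close>; it is at distance at least \<open>\<delta> / 2\<close> from \<open>A\<close>, hence a point of \<open>t\<close> and not an added
  one, hence equal to \<open>x\<close>.  So the matching injects the copies of \<open>x\<close> in \<open>s\<close> into those in \<open>t\<close>.
\<close>

lemma multiplicity_le_if_rep_dist_0:
  assumes P: "metric_pair (X, A)" and p: "1 \<le> p" "p < \<infinity>"
    and t: "t \<in> cmsets (mspace X)" and fin: "rep_dist (X, A) p t cm_empty < \<infinity>"
    and zero: "rep_dist (X, A) p s t = 0"
    and x: "x \<in> mspace X" "x \<notin> A"
  shows "s x \<le> t x"
proof -
  have "openin (mtopology_of X) (mspace X - A)"
    using P by (simp add: metric_pair_def closedin_def)
  then obtain \<delta> where \<delta>: "0 < \<delta>" "Metric_space.mball (mspace X) (mdist X) x \<delta> \<subseteq> mspace X - A"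
    using x by (auto simp: mtopology_of_def Metric_space.openin_mtopology[OF Metric_space_mspace_mdist])
  have far: "\<delta> \<le> mdist X x a" if "a \<in> A" for a
    using \<delta>(2) that x metric_pair_subset[OF P]
    by (force simp: Metric_space.in_mball[OF Metric_space_mspace_mdist] not_less[symmetric])
  define F where "F = fst ` {u \<in> occ t. \<forall>a\<in>A. \<delta> / 2 \<le> mdist X (fst u) a}"
  have F: "finite F" "F \<subseteq> mspace X"
    using finite_far_occurrences[OF p fin, of "\<delta> / 2"] \<delta>(1) fst_occ_in[OF t] by (auto simp: F_def)
  define \<epsilon> where "\<epsilon> = Min (insert (\<delta> / 2) (mdist X x ` (F - {x})))"
  have \<epsilon>: "0 < \<epsilon>" "\<epsilon> \<le> \<delta> / 2" "\<And>y. y \<in> F \<Longrightarrow> y \<noteq> x \<Longrightarrow> \<epsilon> \<le> mdist X x y"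
  proof -
    have "0 < mdist X x y" if "y \<in> F - {x}" for y
      using that F(2) x(1) by (auto simp: order_less_le)
    then show "0 < \<epsilon>" using F(1) \<delta>(1) by (simp add: \<epsilon>_def)
    show "\<epsilon> \<le> \<delta> / 2" unfolding \<epsilon>_def using F(1) by (intro Min_le) auto
    show "\<epsilon> \<le> mdist X x y" if "y \<in> F" "y \<noteq> x" for y
      unfolding \<epsilon>_def using F(1) that by (intro Min_le) auto
  qed
  have "rep_dist (X, A) p s t < ennreal \<epsilon>" using zero \<epsilon>(1) by simp
  then obtain \<alpha> \<beta> where ab: "\<alpha> \<in> cmsets A" "\<beta> \<in> cmsets A"
    and "cm_dist X p (s \<oplus>\<^sub>m \<alpha>) (t \<oplus>\<^sub>m \<beta>) < ennreal \<epsilon>"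
    by (rule rep_dist_lessE)
  then obtain \<phi> where \<phi>: "bij_betw \<phi> (occ (s \<oplus>\<^sub>m \<alpha>)) (occ (t \<oplus>\<^sub>m \<beta>))"
    "lp_size p (occ (s \<oplus>\<^sub>m \<alpha>)) (\<lambda>u. mdist X (fst u) (fst (\<phi> u))) < ennreal \<epsilon>"
    by (metis cm_dist_lessE)
  have outside: "(r \<oplus>\<^sub>m \<gamma>) y = r y" if "\<gamma> \<in> cmsets A" "y \<notin> A" for r \<gamma> y
    using that by (auto simp: cm_add_def cmsets_def)
  have fixed: "fst (\<phi> u) = x" if u: "u \<in> occ (s \<oplus>\<^sub>m \<alpha>)" "fst u = x" for u
  proof (rule ccontr)
    let ?y = "fst (\<phi> u)"
    assume ne: "?y \<noteq> x"
    have \<phi>u: "\<phi> u \<in> occ (t \<oplus>\<^sub>m \<beta>)" using bij_betwE[OF \<phi>(1)] u by blast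
    have y: "?y \<in> mspace X"
      using \<phi>u t metric_pair_cmsets[OF P ab(2)] by (meson fst_occ_in cm_add_in_cmsets)
    have "ennreal (mdist X x ?y) < ennreal \<epsilon>"
      using weight_le_lp_size[OF p(1) u(1), of "\<lambda>u. mdist X (fst u) (fst (\<phi> u))"] \<phi>(2) u(2)
      by (auto intro: order_le_less_trans)
    then have close: "mdist X x ?y < \<epsilon>" by (simp add: ennreal_less_iff)
    have y_far: "\<delta> / 2 \<le> mdist X ?y a" if a: "a \<in> A" for a
    proof -
      have "mdist X x a \<le> mdist X x ?y + mdist X ?y a"
        using a x y metric_pair_subset[OF P] by (intro mdist_triangle) auto
      then show ?thesis using far[OF a] close \<epsilon>(2) by linarith
    qed
    have "?y \<notin> A"
    proof
      assume "?y \<in> A"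
      from y_far[OF this] have "\<delta> / 2 \<le> mdist X ?y ?y" .
      moreover have "mdist X ?y ?y = 0" using y by simp
      ultimately show False using \<delta>(1) by linarith
    qed
    then have "\<phi> u \<in> occ t"
      using \<phi>u outside[OF ab(2), of ?y t] by (auto simp: occ_def)
    then have "?y \<in> F" using y_far by (auto simp: F_def)
    then show False using \<epsilon>(3) ne close by force
  qed
  let ?S = "{u \<in> occ (s \<oplus>\<^sub>m \<alpha>). fst u = x}" and ?T = "{v \<in> occ (t \<oplus>\<^sub>m \<beta>). fst v = x}"
  have "bij_betw \<phi> ?S (\<phi> ` ?S)"
    using bij_betw_imp_inj_on[OF \<phi>(1)] by (auto simp: bij_betw_def intro: inj_on_subset)
  then have "ecard ?S = ecard (\<phi> ` ?S)" by (rule ecard_bij_betw)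
  also have "\<dots> \<le> ecard ?T"
    using bij_betwE[OF \<phi>(1)] fixed by (intro ecard_mono) auto
  finally have "(s \<oplus>\<^sub>m \<alpha>) x \<le> (t \<oplus>\<^sub>m \<beta>) x"
    using cm_of_occ[of "s \<oplus>\<^sub>m \<alpha>"] cm_of_occ[of "t \<oplus>\<^sub>m \<beta>"] by (simp add: cm_of_def fun_eq_iff)
  then show ?thesis using outside ab x(2) by simp
qed

text \<open>
  If \<open>s\<close> and \<open>t\<close> agree outside \<open>A\<close>, then adding to each of them the part of the other one in \<open>A\<close> gives
  the same multiset.
\<close>

lemma diag_rel_if_eq_outside:
  assumes s: "s \<in> cmsets (mspace X)" and t: "t \<in> cmsets (mspace X)"
    and eq: "\<And>x. x \<in> mspace X \<Longrightarrow> x \<notin> A \<Longrightarrow> s x = t x"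
  shows "(s, t) \<in> diag_rel (X, A)"
proof -
  \<comment> \<open>the part of a multiset in \<open>A\<close>\<close>
  define part where "part r = (\<lambda>x. if x \<in> A then r x else (0 :: enat))" for r
  have part: "part r \<in> cmsets A" if "r \<in> cmsets (mspace X)" for r
  proof -
    have "{x. part r x \<noteq> 0} \<subseteq> {x. r x \<noteq> 0}" "{x. part r x \<noteq> 0} \<subseteq> A"
      by (auto simp: part_def)
    then show ?thesis using that by (auto simp: cmsets_def intro: countable_subset)
  qed
  have "s x = t x" if "x \<notin> A" for x
  proof (cases "x \<in> mspace X")
    case True
    then show ?thesis using eq that by blast
  next
    case False
    then have "s x = 0" "t x = 0" using s t by (auto simp: cmsets_def)
    then show ?thesis by simp
  qed
  then have "s \<oplus>\<^sub>m part t = t \<oplus>\<^sub>m part s"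
    by (auto simp: cm_add_def part_def fun_eq_iff add.commute)
  then show ?thesis
    using s t part by (auto simp: diag_rel_def)
qed


section \<open>The spaces of diagrams\<close>

lemma fin_diagrams_iff:
  assumes P: "metric_pair (X, A)" and s: "s \<in> cmsets (mspace X)"
  shows "diag_class (X, A) s \<in> fin_diagrams (X, A) p \<longleftrightarrow> rep_dist (X, A) p s cm_empty < \<infinity>"
  using diag_class_in_diagrams[OF s] diag_dist_class[OF P s cm_empty_in_cmsets]
  by (simp add: fin_diagrams_def empty_diagram_def)

lemma fin_diagramsE:
  assumes P: "metric_pair (X, A)" and \<sigma>: "\<sigma> \<in> fin_diagrams (X, A) p"
  obtains s where "s \<in> cmsets (mspace X)" "\<sigma> = diag_class (X, A) s"
    "rep_dist (X, A) p s cm_empty < \<infinity>"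
proof -
  have "\<sigma> \<in> diagrams (X, A)" using \<sigma> by (simp add: fin_diagrams_def)
  then obtain s where s: "s \<in> cmsets (mspace X)" "\<sigma> = diag_class (X, A) s" by (rule diagramsE)
  then show thesis using \<sigma> fin_diagrams_iff[OF P s(1)] by (intro that) auto
qed

lemma pointed_pseudometric_Dgm_obj:
  assumes P: "metric_pair (X, A)" and p: "1 \<le> p"
  shows "pointed_pseudometric_space (Dgm_obj p (X, A))"
proof -
  let ?M = "fin_diagrams (X, A) p" and ?d = "diag_dist (X, A) p"
  note dist = diag_dist_class[OF P]
  have "empty_diagram (X, A) \<in> ?M"
    unfolding empty_diagram_def fin_diagrams_iff[OF P cm_empty_in_cmsets]
    by (simp add: rep_dist_refl[OF P cm_empty_in_cmsets])
  moreover have "?d \<sigma> \<sigma> = 0" if "\<sigma> \<in> ?M" for \<sigma>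
    using that by (auto elim!: fin_diagramsE[OF P] simp: dist rep_dist_refl[OF P])
  moreover have "?d \<sigma> \<tau> = ?d \<tau> \<sigma>" if "\<sigma> \<in> ?M" "\<tau> \<in> ?M" for \<sigma> \<tau>
    using that by (auto elim!: fin_diagramsE[OF P] simp: dist intro: rep_dist_sym)
  moreover have "?d \<sigma> \<upsilon> \<le> ?d \<sigma> \<tau> + ?d \<tau> \<upsilon>" if "\<sigma> \<in> ?M" "\<tau> \<in> ?M" "\<upsilon> \<in> ?M" for \<sigma> \<tau> \<upsilon>
    using that by (auto elim!: fin_diagramsE[OF P] simp: dist intro: rep_dist_triangle[OF P p])
  moreover have "?d \<sigma> \<tau> < \<infinity>" if "\<sigma> \<in> ?M" "\<tau> \<in> ?M" for \<sigma> \<tau>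
  proof -
    obtain s t where s: "s \<in> cmsets (mspace X)" "\<sigma> = diag_class (X, A) s" "rep_dist (X, A) p s cm_empty < \<infinity>"
      and t: "t \<in> cmsets (mspace X)" "\<tau> = diag_class (X, A) t" "rep_dist (X, A) p t cm_empty < \<infinity>"
      using \<open>\<sigma> \<in> ?M\<close> \<open>\<tau> \<in> ?M\<close> by (metis fin_diagramsE[OF P])
    have "rep_dist (X, A) p s t \<le> rep_dist (X, A) p s cm_empty + rep_dist (X, A) p cm_empty t"
      by (rule rep_dist_triangle[OF P p s(1) cm_empty_in_cmsets t(1)])
    also have "\<dots> < \<infinity>" using s(3) t(3) by (simp add: rep_dist_sym[of X A p cm_empty t])
    finally show ?thesis by (simp add: s(2) t(2) dist s(1) t(1))
  qed
  ultimately show ?thesis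
    unfolding Dgm_obj_def pointed_pseudometric_space_def by simp
qed

lemma pointed_metric_Dgm_obj:
  assumes P: "metric_pair (X, A)" and p: "1 \<le> p" "p < \<infinity>"
  shows "pointed_metric_space (Dgm_obj p (X, A))"
proof -
  have "\<sigma> = \<tau>"
    if \<sigma>: "\<sigma> \<in> fin_diagrams (X, A) p" and \<tau>: "\<tau> \<in> fin_diagrams (X, A) p"
      and zero: "diag_dist (X, A) p \<sigma> \<tau> = 0" for \<sigma> \<tau>
  proof -
    obtain s where s: "s \<in> cmsets (mspace X)" "\<sigma> = diag_class (X, A) s" "rep_dist (X, A) p s cm_empty < \<infinity>"
      using \<sigma> by (rule fin_diagramsE[OF P])
    obtain t where t: "t \<in> cmsets (mspace X)" "\<tau> = diag_class (X, A) t" "rep_dist (X, A) p t cm_empty < \<infinity>"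
      using \<tau> by (rule fin_diagramsE[OF P])
    have st: "rep_dist (X, A) p s t = 0"
      using zero diag_dist_class[OF P s(1) t(1)] s(2) t(2) by simp
    have "s x = t x" if "x \<in> mspace X" "x \<notin> A" for x
    proof (rule antisym)
      show "s x \<le> t x"
        by (rule multiplicity_le_if_rep_dist_0[OF P p t(1) t(3) st that])
      show "t x \<le> s x"
        by (rule multiplicity_le_if_rep_dist_0[OF P p s(1) s(3) _ that])
          (simp add: rep_dist_sym[of X A p t s] st)
    qed
    then show ?thesis
      using diag_rel_if_eq_outside[OF s(1) t(1)] diag_class_eq_iff[OF s(1) t(1)] s(2) t(2) by blast
  qed
  then show ?thesis
    using pointed_pseudometric_Dgm_obj[OF P p(1)]
    by (auto simp: pointed_metric_space_def Dgm_obj_def)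
qed


section \<open>The induced maps\<close>

lemma rel_Lipschitz_mapsD:
  assumes "f \<in> rel_Lipschitz_maps (X, A) (Y, B)"
  shows "f \<in> extensional (mspace X)" "Lipschitz_continuous_map X Y f"
    "f ` mspace X \<subseteq> mspace Y" "f ` A \<subseteq> B"
  using assms by (auto simp: rel_Lipschitz_maps_def dest: Lipschitz_continuous_map_image)

lemma diag_rel_cm_image:
  assumes fX: "f ` mspace X \<subseteq> mspace Y" and fA: "f ` A \<subseteq> B"
    and st: "(s, t) \<in> diag_rel (X, A)"
  shows "(cm_image f s, cm_image f t) \<in> diag_rel (Y, B)"
proof -
  obtain \<alpha> \<beta> where *: "s \<in> cmsets (mspace X)" "t \<in> cmsets (mspace X)"
    "\<alpha> \<in> cmsets A" "\<beta> \<in> cmsets A" "s \<oplus>\<^sub>m \<alpha> = t \<oplus>\<^sub>m \<beta>"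
    using st by (auto simp: diag_rel_def)
  have "cm_image f s \<oplus>\<^sub>m cm_image f \<alpha> = cm_image f t \<oplus>\<^sub>m cm_image f \<beta>"
    using *(5) by (simp flip: cm_image_add)
  then show ?thesis
    using *(1-4) cm_image_in_cmsets fX fA unfolding diag_rel_def by blast
qed

text \<open>
  The map is well defined on classes, so the union in the definition of \<^const>\<open>push\<close> is a union of
  equal sets.
\<close>

lemma push_diag_class:
  assumes fX: "f ` mspace X \<subseteq> mspace Y" and fA: "f ` A \<subseteq> B" and s: "s \<in> cmsets (mspace X)"
  shows "push (Y, B) f (diag_class (X, A) s) = diag_class (Y, B) (cm_image f s)"
proof -
  have "diag_class (Y, B) (cm_image f t) = diag_class (Y, B) (cm_image f s)"
    if "t \<in> diag_class (X, A) s" for t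
  proof -
    have st: "(s, t) \<in> diag_rel (X, A)" using that by (simp add: diag_class_def)
    then have "t \<in> cmsets (mspace X)" by (simp add: diag_rel_def)
    then show ?thesis
      using diag_rel_cm_image[OF fX fA st] diag_class_eq_iff cm_image_in_cmsets[OF _ fX] s by metis
  qed
  moreover have "s \<in> diag_class (X, A) s"
    using equiv_class_self[OF equiv_diag_rel s] by (simp add: diag_class_def)
  ultimately show ?thesis unfolding push_def by blast
qed

text \<open>
  The Lipschitz estimate for the pair of a diagram and the empty diagram, which is mapped to the empty
  diagram, also shows that the image has finite distance to the empty diagram.
\<close>

lemma Dgm_map_pointed_Lipschitz:
  assumes P: "metric_pair (X, A)" and Q: "metric_pair (Y, B)" and p: "1 \<le> p"
    and f: "f \<in> rel_Lipschitz_maps (X, A) (Y, B)"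
  shows "Dgm_map p (X, A) (Y, B) f \<in> pointed_Lipschitz_maps (Dgm_obj p (X, A)) (Dgm_obj p (Y, B))"
proof -
  note fX = rel_Lipschitz_mapsD(3)[OF f] and fA = rel_Lipschitz_mapsD(4)[OF f]
  note push = push_diag_class[OF fX fA] and image_in = cm_image_in_cmsets[OF _ fX]
  obtain L where L: "0 < L"
    and le: "\<And>x y. x \<in> mspace X \<Longrightarrow> y \<in> mspace X \<Longrightarrow> mdist Y (f x) (f y) \<le> L * mdist X x y"
    using rel_Lipschitz_mapsD(2)[OF f] unfolding Lipschitz_continuous_map_pos by blast
  have rep_le: "rep_dist (Y, B) p (cm_image f s) (cm_image f t) \<le> ennreal L * rep_dist (X, A) p s t"
    if "s \<in> cmsets (mspace X)" "t \<in> cmsets (mspace X)" for s t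
    by (rule rep_dist_image_le[OF P p L _ fA that]) (rule le)
  let ?M = "fin_diagrams (X, A) p" and ?e = "empty_diagram (X, A)"
  have base: "push (Y, B) f ?e = empty_diagram (Y, B)"
    by (simp add: empty_diagram_def push cm_empty_in_cmsets cm_image_empty)
  have e: "?e \<in> ?M"
    using pointed_pseudometric_Dgm_obj[OF P p] by (simp add: pointed_pseudometric_space_def Dgm_obj_def)
  have "diag_dist (Y, B) p (push (Y, B) f \<sigma>) (push (Y, B) f \<tau>) \<le> ennreal L * diag_dist (X, A) p \<sigma> \<tau>"
    if "\<sigma> \<in> ?M" "\<tau> \<in> ?M" for \<sigma> \<tau>
    using that
    by (auto elim!: fin_diagramsE[OF P] simp: push diag_dist_class[OF P] diag_dist_class[OF Q] image_in intro: rep_le)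
  moreover have "push (Y, B) f \<sigma> \<in> fin_diagrams (Y, B) p" if \<sigma>: "\<sigma> \<in> ?M" for \<sigma>
  proof -
    obtain s where s: "s \<in> cmsets (mspace X)" "\<sigma> = diag_class (X, A) s" "rep_dist (X, A) p s cm_empty < \<infinity>"
      using \<sigma> by (rule fin_diagramsE[OF P])
    have "rep_dist (Y, B) p (cm_image f s) cm_empty \<le> ennreal L * rep_dist (X, A) p s cm_empty"
      using rep_le[OF s(1) cm_empty_in_cmsets] by (simp add: cm_image_empty)
    also have "\<dots> < \<infinity>" using s(3) by (simp add: ennreal_mult_less_top)
    finally show ?thesis
      using s by (simp add: push fin_diagrams_iff[OF Q image_in])
  qed
  ultimately show ?thesis
    using base e unfolding pointed_Lipschitz_maps_def Dgm_obj_def Dgm_map_def by auto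
qed

lemma Dgm_map_Idt:
  assumes P: "metric_pair (X, A)"
  shows "Dgm_map p (X, A) (X, A) (restrict id (mspace X)) = restrict id (fin_diagrams (X, A) p)"
proof -
  have "push (X, A) (restrict id (mspace X)) \<sigma> = \<sigma>" if \<sigma>: "\<sigma> \<in> fin_diagrams (X, A) p" for \<sigma>
  proof -
    obtain s where s: "s \<in> cmsets (mspace X)" "\<sigma> = diag_class (X, A) s"
      using \<sigma> by (rule fin_diagramsE[OF P])
    have "cm_image (restrict id (mspace X)) s = s"
      using cm_image_cong[OF s(1), of "restrict id (mspace X)" id] by (simp add: cm_image_id)
    moreover have "push (X, A) (restrict id (mspace X)) (diag_class (X, A) s)
        = diag_class (X, A) (cm_image (restrict id (mspace X)) s)"
      using metric_pair_subset[OF P] s(1) by (intro push_diag_class) auto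
    ultimately show ?thesis by (simp add: s(2))
  qed
  then show ?thesis by (auto simp: Dgm_map_def fun_eq_iff)
qed

lemma Dgm_map_Cmp:
  assumes P: "metric_pair (X, A)" and Q: "metric_pair (Y, B)" and p: "1 \<le> p"
    and f: "f \<in> rel_Lipschitz_maps (X, A) (Y, B)" and g: "g \<in> rel_Lipschitz_maps (Y, B) (Z, C)"
  shows "Dgm_map p (X, A) (Z, C) (compose (mspace X) g f)
    = compose (fin_diagrams (X, A) p) (Dgm_map p (Y, B) (Z, C) g) (Dgm_map p (X, A) (Y, B) f)"
proof -
  note fX = rel_Lipschitz_mapsD(3)[OF f] and fA = rel_Lipschitz_mapsD(4)[OF f]
  note gY = rel_Lipschitz_mapsD(3)[OF g] and gB = rel_Lipschitz_mapsD(4)[OF g]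
  have "push (Z, C) (compose (mspace X) g f) \<sigma> = push (Z, C) g (push (Y, B) f \<sigma>)"
    if \<sigma>: "\<sigma> \<in> fin_diagrams (X, A) p" for \<sigma>
  proof -
    obtain s where s: "s \<in> cmsets (mspace X)" "\<sigma> = diag_class (X, A) s"
      using \<sigma> by (rule fin_diagramsE[OF P])
    have "push (Z, C) (compose (mspace X) g f) \<sigma> = diag_class (Z, C) (cm_image (compose (mspace X) g f) s)"
      unfolding s(2)
    proof (rule push_diag_class[OF _ _ s(1)])
      show "compose (mspace X) g f ` mspace X \<subseteq> mspace Z"
        using fX gY by (force simp: compose_def)
      show "compose (mspace X) g f ` A \<subseteq> C"
        using fA gB metric_pair_subset[OF P] by (force simp: compose_def)
    qed
    also have "cm_image (compose (mspace X) g f) s = cm_image g (cm_image f s)"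
      unfolding cm_image_comp[OF s(1)] using s(1) by (rule cm_image_cong) (simp add: compose_def)
    also have "diag_class (Z, C) \<dots> = push (Z, C) g (push (Y, B) f \<sigma>)"
      unfolding s(2) push_diag_class[OF fX fA s(1)]
      by (rule push_diag_class[OF gY gB cm_image_in_cmsets[OF s(1) fX], symmetric])
    finally show ?thesis .
  qed
  moreover have "push (Y, B) f \<sigma> \<in> fin_diagrams (Y, B) p" if "\<sigma> \<in> fin_diagrams (X, A) p" for \<sigma>
    using Dgm_map_pointed_Lipschitz[OF P Q p f] that
    by (auto simp: pointed_Lipschitz_maps_def Dgm_obj_def Dgm_map_def PiE_iff)
  ultimately show ?thesis
    by (auto simp: Dgm_map_def compose_def fun_eq_iff)
qed


section \<open>The categories and the functor\<close>

lemma category_MetPairs: "category (MetPairs :: ('a metric \<times> 'a set, 'a \<Rightarrow> 'a) cat)"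
proof
  fix P :: "'a metric \<times> 'a set"
  assume "P \<in> Obj MetPairs"
  then show "Idt MetPairs P \<in> Hom MetPairs P P"
    using metric_pair_subset[of "fst P" "snd P"]
      Lipschitz_continuous_map_eq[OF Lipschitz_continuous_map_id, of "fst P" "restrict id (mspace (fst P))"]
    by (auto simp: MetPairs_def rel_Lipschitz_maps_def)
next
  fix P Q R :: "'a metric \<times> 'a set" and f g
  assume PQR: "P \<in> Obj MetPairs" "Q \<in> Obj MetPairs" "R \<in> Obj MetPairs"
    and fg: "f \<in> Hom MetPairs P Q" "g \<in> Hom MetPairs Q R"
  obtain X A Y B Z C where eq: "P = (X, A)" "Q = (Y, B)" "R = (Z, C)" by (metis prod.exhaust)
  have f: "f \<in> rel_Lipschitz_maps (X, A) (Y, B)" and g: "g \<in> rel_Lipschitz_maps (Y, B) (Z, C)"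
    using fg by (simp_all add: MetPairs_def eq)
  have "Lipschitz_continuous_map X Z (compose (mspace X) g f)"
    using Lipschitz_continuous_map_compose[OF rel_Lipschitz_mapsD(2)[OF f] rel_Lipschitz_mapsD(2)[OF g]]
    by (rule Lipschitz_continuous_map_eq) (simp add: compose_def)
  moreover have "compose (mspace X) g f ` A \<subseteq> C"
    using rel_Lipschitz_mapsD(4)[OF f] rel_Lipschitz_mapsD(4)[OF g] metric_pair_subset[of X A] PQR(1)
    by (auto simp: compose_def MetPairs_def eq)
  ultimately show "Cmp MetPairs P Q R g f \<in> Hom MetPairs P R"
    by (simp add: MetPairs_def rel_Lipschitz_maps_def eq)
next
  fix P Q :: "'a metric \<times> 'a set" and f
  assume "f \<in> Hom MetPairs P Q"
  then have f: "f \<in> extensional (mspace (fst P))" "f ` mspace (fst P) \<subseteq> mspace (fst Q)"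
    using rel_Lipschitz_mapsD[of f "fst P" "snd P" "fst Q" "snd Q"] by (simp_all add: MetPairs_def)
  then show "Cmp MetPairs P Q Q (Idt MetPairs Q) f = f" "Cmp MetPairs P P Q f (Idt MetPairs P) = f"
    by (auto simp: MetPairs_def compose_def fun_eq_iff extensional_def split_beta)
next
  fix P Q R S :: "'a metric \<times> 'a set" and f g h
  assume "f \<in> Hom MetPairs P Q"
  then have "f ` mspace (fst P) \<subseteq> mspace (fst Q)"
    using rel_Lipschitz_mapsD[of f "fst P" "snd P" "fst Q" "snd Q"] by (simp add: MetPairs_def)
  then show "Cmp MetPairs P R S h (Cmp MetPairs P Q R g f) = Cmp MetPairs P Q S (Cmp MetPairs Q R S h g) f"
    by (auto simp: MetPairs_def compose_def fun_eq_iff split_beta)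
qed

lemma category_PtPseudoMet: "category (PtPseudoMet :: ('b pointed_space, 'b \<Rightarrow> 'b) cat)"
proof
  fix S :: "'b pointed_space"
  assume "S \<in> Obj PtPseudoMet"
  then show "Idt PtPseudoMet S \<in> Hom PtPseudoMet S S"
    by (auto simp: PtPseudoMet_def pointed_Lipschitz_maps_def pointed_pseudometric_space_def intro!: exI[of _ 1])
next
  fix S T U :: "'b pointed_space" and f g
  assume STU: "S \<in> Obj PtPseudoMet" and fg: "f \<in> Hom PtPseudoMet S T" "g \<in> Hom PtPseudoMet T U"
  obtain M d b M' d' b' M'' d'' b''
    where eq: "S = (M, d, b)" "T = (M', d', b')" "U = (M'', d'', b'')" by (metis prod.exhaust)
  obtain K where f: "f \<in> M \<rightarrow>\<^sub>E M'" "f b = b'"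
    and K: "\<And>x y. x \<in> M \<Longrightarrow> y \<in> M \<Longrightarrow> d' (f x) (f y) \<le> ennreal K * d x y"
    using fg(1) by (auto simp: PtPseudoMet_def pointed_Lipschitz_maps_def eq)
  obtain L where g: "g \<in> M' \<rightarrow>\<^sub>E M''" "g b' = b''"
    and L: "\<And>x y. x \<in> M' \<Longrightarrow> y \<in> M' \<Longrightarrow> d'' (g x) (g y) \<le> ennreal L * d' x y"
    using fg(2) by (auto simp: PtPseudoMet_def pointed_Lipschitz_maps_def eq)
  \<comment> \<open>Lipschitz constants of pointed maps may be negative, and then they count as zero; truncating
    them first makes the product the right constant for the composite.\<close>
  have "d'' (g (f x)) (g (f y)) \<le> ennreal (max 0 L * max 0 K) * d x y" if "x \<in> M" "y \<in> M" for x y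
  proof -
    have "d'' (g (f x)) (g (f y)) \<le> ennreal L * d' (f x) (f y)"
      using f(1) that by (intro L) auto
    also have "\<dots> \<le> ennreal L * (ennreal K * d x y)"
      using K[OF that] by (rule mult_left_mono) simp
    also have "\<dots> = ennreal (max 0 L * max 0 K) * d x y"
      by (simp add: ennreal_mult ennreal_max_0 mult.assoc)
    finally show ?thesis .
  qed
  then have "\<exists>N. \<forall>x\<in>M. \<forall>y\<in>M. d'' (compose M g f x) (compose M g f y) \<le> ennreal N * d x y"
    by (intro exI[of _ "max 0 L * max 0 K"]) (simp add: compose_def)
  moreover have "b \<in> M" using STU by (simp add: PtPseudoMet_def pointed_pseudometric_space_def eq)
  ultimately show "Cmp PtPseudoMet S T U g f \<in> Hom PtPseudoMet S U"
    using f g by (auto simp: PtPseudoMet_def pointed_Lipschitz_maps_def eq compose_def PiE_iff)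
next
  fix S T :: "'b pointed_space" and f
  assume "f \<in> Hom PtPseudoMet S T"
  then have "f \<in> fst S \<rightarrow>\<^sub>E fst T"
    by (auto simp: PtPseudoMet_def pointed_Lipschitz_maps_def)
  then show "Cmp PtPseudoMet S T T (Idt PtPseudoMet T) f = f" "Cmp PtPseudoMet S S T f (Idt PtPseudoMet S) = f"
    by (auto simp: PtPseudoMet_def compose_def fun_eq_iff PiE_iff extensional_def split_beta)
next
  fix S T U V :: "'b pointed_space" and f g h
  assume "f \<in> Hom PtPseudoMet S T"
  then have "f \<in> fst S \<rightarrow>\<^sub>E fst T"
    by (auto simp: PtPseudoMet_def pointed_Lipschitz_maps_def)
  then show "Cmp PtPseudoMet S U V h (Cmp PtPseudoMet S T U g f)
      = Cmp PtPseudoMet S T V (Cmp PtPseudoMet T U V h g) f"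
    by (auto simp: PtPseudoMet_def compose_def fun_eq_iff PiE_iff split_beta)
qed

lemma full_subcategory:
  assumes "category C" "O' \<subseteq> Obj C"
  shows "category (C\<lparr>Obj := O'\<rparr>)"
proof -
  interpret category C by fact
  show ?thesis
    using assms(2) by unfold_locales
      (auto intro!: Idt_in_Hom Cmp_in_Hom Cmp_Idt_left Cmp_Idt_right Cmp_assoc)
qed

text \<open>
  Both targets are full subcategories of the category of pointed pseudometric spaces, so the two parts
  of the theorem differ only in which spaces the values of the functor on objects are known to be.
\<close>

lemma cat_functor_Dgm:
  fixes p :: ennreal and Sp :: "'a diagram pointed_space set"
  assumes p: "1 \<le> p" and Sp: "Sp \<subseteq> {S. pointed_pseudometric_space S}"
    and obj: "\<And>P. metric_pair P \<Longrightarrow> Dgm_obj p P \<in> Sp"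
  shows "cat_functor (MetPairs :: ('a metric \<times> 'a set, 'a \<Rightarrow> 'a) cat) (PtPseudoMet\<lparr>Obj := Sp\<rparr>)
    (Dgm_obj p) (Dgm_map p)"
proof (rule cat_functor.intro)
  show "category MetPairs" by (rule category_MetPairs)
  show "category (PtPseudoMet\<lparr>Obj := Sp\<rparr>)"
    using Sp by (intro full_subcategory category_PtPseudoMet) (simp add: PtPseudoMet_def)
  show "cat_functor_axioms (MetPairs :: ('a metric \<times> 'a set, 'a \<Rightarrow> 'a) cat) (PtPseudoMet\<lparr>Obj := Sp\<rparr>)
    (Dgm_obj p) (Dgm_map p)"
  proof
    fix P :: "'a metric \<times> 'a set" assume P: "P \<in> Obj MetPairs"
    then show "Dgm_obj p P \<in> Obj (PtPseudoMet\<lparr>Obj := Sp\<rparr>)"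
      using obj by (simp add: MetPairs_def)
    show "Dgm_map p P P (Idt MetPairs P) = Idt (PtPseudoMet\<lparr>Obj := Sp\<rparr>) (Dgm_obj p P)"
      using P Dgm_map_Idt[of "fst P" "snd P" p]
      by (simp add: MetPairs_def PtPseudoMet_def Dgm_obj_def split_beta)
  next
    fix P Q :: "'a metric \<times> 'a set" and f
    assume "P \<in> Obj MetPairs" "Q \<in> Obj MetPairs" "f \<in> Hom MetPairs P Q"
    then show "Dgm_map p P Q f \<in> Hom (PtPseudoMet\<lparr>Obj := Sp\<rparr>) (Dgm_obj p P) (Dgm_obj p Q)"
      using Dgm_map_pointed_Lipschitz[OF _ _ p, of "fst P" "snd P" "fst Q" "snd Q" f]
      by (simp add: MetPairs_def PtPseudoMet_def)
  next
    fix P Q R :: "'a metric \<times> 'a set" and f g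
    assume "P \<in> Obj MetPairs" "Q \<in> Obj MetPairs" "R \<in> Obj MetPairs"
      "f \<in> Hom MetPairs P Q" "g \<in> Hom MetPairs Q R"
    then show "Dgm_map p P R (Cmp MetPairs P Q R g f) = Cmp (PtPseudoMet\<lparr>Obj := Sp\<rparr>)
        (Dgm_obj p P) (Dgm_obj p Q) (Dgm_obj p R) (Dgm_map p Q R g) (Dgm_map p P Q f)"
      using Dgm_map_Cmp[OF _ _ p, of "fst P" "snd P" "fst Q" "snd Q" f g "fst R" "snd R"]
      by (simp add: MetPairs_def PtPseudoMet_def Dgm_obj_def split_beta)
  qed
qed

theorem proposition2p9:
  fixes p :: ennreal
  shows "(p = \<infinity> \<longrightarrow>
            cat_functor (MetPairs :: ('a metric \<times> 'a set, 'a \<Rightarrow> 'a) cat) PtPseudoMet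
              (Dgm_obj p) (Dgm_map p))
       \<and> (1 \<le> p \<and> p < \<infinity> \<longrightarrow>
            cat_functor (MetPairs :: ('a metric \<times> 'a set, 'a \<Rightarrow> 'a) cat) PtMet
              (Dgm_obj p) (Dgm_map p))"
proof (intro conjI impI)
  assume "p = \<infinity>"
  then have p: "1 \<le> p" by simp
  have "cat_functor (MetPairs :: ('a metric \<times> 'a set, 'a \<Rightarrow> 'a) cat)
      (PtPseudoMet\<lparr>Obj := {S. pointed_pseudometric_space S}\<rparr>) (Dgm_obj p) (Dgm_map p)"
    by (rule cat_functor_Dgm[OF p]) (auto intro: pointed_pseudometric_Dgm_obj[OF _ p])
  then show "cat_functor (MetPairs :: ('a metric \<times> 'a set, 'a \<Rightarrow> 'a) cat) PtPseudoMet
      (Dgm_obj p) (Dgm_map p)"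
    by (simp add: PtPseudoMet_def)
next
  assume p: "1 \<le> p \<and> p < \<infinity>"
  show "cat_functor (MetPairs :: ('a metric \<times> 'a set, 'a \<Rightarrow> 'a) cat) PtMet
      (Dgm_obj p) (Dgm_map p)"
    unfolding PtMet_def
  proof (rule cat_functor_Dgm)
    show "{S. pointed_metric_space S} \<subseteq> {S. pointed_pseudometric_space S}"
      by (auto simp: pointed_metric_space_def)
    show "Dgm_obj p P \<in> {S. pointed_metric_space S}" if "metric_pair P" for P :: "'a metric \<times> 'a set"
      using pointed_metric_Dgm_obj[of "fst P" "snd P" p] that p by simp
  qed (use p in simp)
qed

end
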